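(* Let $\alpha,\gamma,\kappa>-1$ be real numbers with $\alpha+\kappa>-\frac32$. Any linear partial differential operator with real polynomial coefficients in $u$ and $v$ that admits the polynomials \[ \{q_{n,k}^{\alpha,\gamma,\kappa}(u,v):\ n,k\in\mathbb{N}_0\} \] as eigenfunctions can be written uniquely as a polynomial in $\mathcal{D}_{1}^{\alpha,\gamma,\kappa}$ and $\mathcal{D}_{2}^{\alpha,\kappa}$.
   Context: All scalars are real (so "polynomial in $\mathcal{D}_{1}^{\alpha,\gamma,\kappa}$ and $\mathcal{D}_{2}^{\alpha,\kappa}$" means $P(\mathcal{D}_{1}^{\alpha,\gamma,\kappa},\mathcal{D}_{2}^{\alpha,\kappa})$ with $P\in\mathbb{R}[X,Y]$). A linear partial differential operator with real polynomial coefficients is a finite sum $\sum_{r,s\ge0}a_{r,s}(u,v)\partial_u^r\partial_v^s$ with $a_{r,s}\in\mathbb{R}[u,v]$. An operator $\mathcal D$ admits the $q_{n,k}$ as eigenfunctions if for every $n,k$ there is a scalar $\Lambda_{\mathcal D}(n,k)$ (possibly zero) with $\mathcal D[q_{n,k}]=\Lambda_{\mathcal D}(n,k)\,q_{n,k}$. Let $\mathbf{T}^2=\{(x,y)\in\mathbb{R}^2:\ x\ge0,\ y\ge0,\ x+y\le1\}$, $\triangle=\{(x,y)\in\mathbf{T}^2:\ y<x\}$, and \[ w_{\alpha,\gamma,\kappa}(x,y)=(xy)^{\alpha}(1-x-y)^{\gamma}|x-y|^{2\kappa+1}. \] Order on $\mathbb{N}_0^2$ (with $\mathbb{N}_0$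 the nonnegative integers): $(m,l)\prec(n,k)$ if and only if $m+2l<n+2k$, or $m+2l=n+2k$ and $l<k$; this is a strict total order. Every symmetric polynomial (invariant under interchange of $x$ and $y$) is uniquely a finite linear combination of the monomials $(x+y)^n(xy)^k$; the largest pair $(n,k)$ (for $\prec$) occurring with nonzero coefficient is its symmetric degree. The monic orthogonal basis $p_{n,k}^{\alpha,\gamma,\kappa}$ is obtained by Gram--Schmidt: $p_{n,k}^{\alpha,\gamma,\kappa}$ is the unique symmetric polynomial equal to $(x+y)^n(xy)^k$ plus a linear combination of $(x+y)^m(xy)^l$ with $(m,l)\prec(n,k)$, and satisfying $\int_{\triangle}p_{n,k}^{\alpha,\gamma,\kappa}\,q\,w_{\alpha,\gamma,\kappa}\,dx\,dy=0$ for every symmetric polynomial $q$ of symmetric degree $\prec(n,k)$. The polynomial $q_{n,k}^{\alpha,\gamma,\kappa}(u,v)$ is defined by $q_{n,k}^{\alpha,\gamma,\kappa}(x+y,xy)=p_{n,k}^{\alpha,\gamma,\kappa}(x,y)$. Equivalently, the $q_{n,k}^{\alpha,\gamma,\kappa}$ are the monic (leading term $u^nv^k$ for $\prec$) orthogonal polynomials for the weight $v^\alpha(1-u)^\gamma(u^2-4v)^\kappa$ on $\Omega=\{(u,v):0<u<1,\ 0<v<u^2/4\}$. In the variables $u=x+y$, $v=xy$ the two operators are \[ \begin{aligned} \mathcal{D}_{1}^{\alpha,\gamma,\kappa}&=u(1-u)\partial_u^2+4v(1-u)\partial_u\partial_v+v(u-4v)\partial_v^2\\ &\quad+\bigl[2\alpha+2\kappa+3-(2\alpha+2\kappa+\gamma+4)u\bigr]\partial_u+\bigl[(\alpha+1)u-2(2\alpha+2\kappa+\gamma+5)v\bigr]\partial_v,\\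 \mathcal D_2^{\alpha,\kappa}&=-v(u^2-4v)\partial_v^2+\left[-(\alpha+1)u^2+4(\alpha+\kappa+2)v\right]\partial_v . \end{aligned} \] *)

theory Defs
  imports "HOL-Analysis.Analysis" "HOL-Computational_Algebra.Polynomial"
begin

text \<open>
  Bivariate real polynomials are elements of \<open>real poly poly\<close>: the first variable
  (\<open>x\<close>, \<open>u\<close> or \<open>X\<close>) is the inner one, the second (\<open>y\<close>, \<open>v\<close> or \<open>Y\<close>) the outer one.
\<close>

type_synonym bipoly = "real poly poly"

definition biconst :: "real \<Rightarrow> bipoly" where
  "biconst c = [:[:c:]:]"

definition var1 :: bipoly where
  "var1 = [:[:0, 1:]:]"

definition var2 :: bipoly where
  "var2 = [:0, 1:]"

definition bieval :: "bipoly \<Rightarrow> real \<Rightarrow> real \<Rightarrow> real" where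
  "bieval p x y = poly (poly p [:y:]) x"

definition triangle :: "(real \<times> real) set" where
  "triangle = {(x, y). x \<ge> 0 \<and> y \<ge> 0 \<and> x + y \<le> 1 \<and> y < x}"

text \<open>
  Since \<open>0 powr a = 0\<close>, the weight is \<open>0\<close> where a factor vanishes, which happens inside
  the triangle only on its boundary, a null set.
\<close>

definition weight :: "real \<Rightarrow> real \<Rightarrow> real \<Rightarrow> real \<Rightarrow> real \<Rightarrow> real" where
  "weight \<alpha> \<gamma> \<kappa> x y =
     (x * y) powr \<alpha> * (1 - x - y) powr \<gamma> * \<bar>x - y\<bar> powr (2 * \<kappa> + 1)"

definition prec :: "nat \<times> nat \<Rightarrow> nat \<times> nat \<Rightarrow> bool" (infix "\<prec>" 50) where
  "z \<prec> w \<longleftrightarrow> (case (z, w) of ((m, l), (n, k)) \<Rightarrow>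
     m + 2 * l < n + 2 * k \<or> (m + 2 * l = n + 2 * k \<and> l < k))"

definition symmetric :: "bipoly \<Rightarrow> bool" where
  "symmetric p \<longleftrightarrow> (\<forall>x y. bieval p x y = bieval p y x)"

definition sym_monom :: "nat \<times> nat \<Rightarrow> bipoly" where
  "sym_monom z = (case z of (n, k) \<Rightarrow> (var1 + var2) ^ n * (var1 * var2) ^ k)"

text \<open>The zero polynomial has no symmetric degree; hence a relation.\<close>

definition has_sym_degree :: "bipoly \<Rightarrow> nat \<times> nat \<Rightarrow> bool" where
  "has_sym_degree p d \<longleftrightarrow> (\<exists>c :: nat \<times> nat \<Rightarrow> real.
     finite {z. c z \<noteq> 0} \<and>
     p = (\<Sum>z | c z \<noteq> 0. biconst (c z) * sym_monom z) \<and>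
     c d \<noteq> 0 \<and> (\<forall>z. c z \<noteq> 0 \<longrightarrow> z = d \<or> z \<prec> d))"

text \<open>
  Each pair has only finitely many predecessors for \<open>\<prec>\<close>, so the sum below ranges over a
  finite index set.
\<close>

definition is_monic_orthogonal ::
    "real \<Rightarrow> real \<Rightarrow> real \<Rightarrow> nat \<Rightarrow> nat \<Rightarrow> bipoly \<Rightarrow> bool" where
  "is_monic_orthogonal \<alpha> \<gamma> \<kappa> n k p \<longleftrightarrow>
     symmetric p \<and>
     (\<exists>c :: nat \<times> nat \<Rightarrow> real.
        p = sym_monom (n, k) + (\<Sum>z | z \<prec> (n, k). biconst (c z) * sym_monom z)) \<and>
     (\<forall>q d. symmetric q \<longrightarrow> has_sym_degree q d \<longrightarrow> d \<prec> (n, k) \<longrightarrow>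
        (LINT (x, y) : triangle | lborel.
           bieval p x y * bieval q x y * weight \<alpha> \<gamma> \<kappa> x y) = 0)"

definition p_poly :: "real \<Rightarrow> real \<Rightarrow> real \<Rightarrow> nat \<Rightarrow> nat \<Rightarrow> bipoly" where
  "p_poly \<alpha> \<gamma> \<kappa> n k = (THE p. is_monic_orthogonal \<alpha> \<gamma> \<kappa> n k p)"

definition q_poly :: "real \<Rightarrow> real \<Rightarrow> real \<Rightarrow> nat \<Rightarrow> nat \<Rightarrow> bipoly" where
  "q_poly \<alpha> \<gamma> \<kappa> n k =
     (THE q. \<forall>x y. bieval q (x + y) (x * y) = bieval (p_poly \<alpha> \<gamma> \<kappa> n k) x y)"

definition du :: "bipoly \<Rightarrow> bipoly" where
  "du = map_poly pderiv"

definition dv :: "bipoly \<Rightarrow> bipoly" where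
  "dv = pderiv"

text \<open>
  Operators are identified with their action on \<open>\<real>[u, v]\<close>. In characteristic \<open>0\<close> this
  action determines the coefficients \<open>a r s\<close>, so equality of operators is equality of maps,
  and the product of operators is composition.
\<close>

definition linear_pdo :: "(bipoly \<Rightarrow> bipoly) \<Rightarrow> bool" where
  "linear_pdo D \<longleftrightarrow> (\<exists>a :: nat \<Rightarrow> nat \<Rightarrow> bipoly.
     finite {(r, s). a r s \<noteq> 0} \<and>
     (\<forall>f. D f = (\<Sum>(r, s) \<in> {(r, s). a r s \<noteq> 0}. a r s * (du ^^ r) ((dv ^^ s) f))))"

definition admits_eigenfunctions ::
    "(bipoly \<Rightarrow> bipoly) \<Rightarrow> (nat \<Rightarrow> nat \<Rightarrow> bipoly) \<Rightarrow> bool" where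
  "admits_eigenfunctions D q \<longleftrightarrow>
     (\<forall>n k. \<exists>\<Lambda> :: real. D (q n k) = biconst \<Lambda> * q n k)"

definition D1 :: "real \<Rightarrow> real \<Rightarrow> real \<Rightarrow> bipoly \<Rightarrow> bipoly" where
  "D1 \<alpha> \<gamma> \<kappa> f = (let u = var1; v = var2 in
     u * (1 - u) * du (du f)
     + 4 * v * (1 - u) * du (dv f)
     + v * (u - 4 * v) * dv (dv f)
     + (biconst (2 * \<alpha> + 2 * \<kappa> + 3) - biconst (2 * \<alpha> + 2 * \<kappa> + \<gamma> + 4) * u) * du f
     + (biconst (\<alpha> + 1) * u - biconst (2 * (2 * \<alpha> + 2 * \<kappa> + \<gamma> + 5)) * v) * dv f)"

definition D2 :: "real \<Rightarrow> real \<Rightarrow> bipoly \<Rightarrow> bipoly" where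
  "D2 \<alpha> \<kappa> f = (let u = var1; v = var2 in
     - v * (u ^ 2 - 4 * v) * dv (dv f)
     + (- biconst (\<alpha> + 1) * u ^ 2 + biconst (4 * (\<alpha> + \<kappa> + 2)) * v) * dv f)"

text \<open>
  \<open>poly_op P A B\<close> is \<open>P(A, B)\<close>, with the powers of \<open>A\<close> written to the left of those of
  \<open>B\<close>. The order is immaterial for the commuting operators \<open>D1\<close> and \<open>D2\<close>.
\<close>

definition poly_op ::
    "bipoly \<Rightarrow> (bipoly \<Rightarrow> bipoly) \<Rightarrow> (bipoly \<Rightarrow> bipoly) \<Rightarrow> bipoly \<Rightarrow> bipoly" where
  "poly_op P A B f =
     (\<Sum>j\<le>degree P. \<Sum>i\<le>degree (coeff P j).
        biconst (coeff (coeff P j) i) * (A ^^ i) ((B ^^ j) f))"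

end

theory Submission
  imports Defs
begin

text \<open>
  The moments of the weight in the variables \<open>u = x + y\<close>, \<open>v = x y\<close> are products of two Beta
  values, and their recurrences say that \<open>D1\<close> and \<open>D2\<close> are symmetric on monomials. Both operators
  are triangular for \<open>\<prec>\<close>, so every \<open>q\<^sub>n\<^sub>k\<close> is a joint eigenfunction, with eigenvalues
  \<open>\<lambda>\<^sub>1\<close> and \<open>\<lambda>\<^sub>2\<close>, say.

  The point \<open>(u, v) = (1, 0)\<close>, a vertex of the region \<open>\<Omega>\<close>, is a regular singular point of the
  system \<open>D1 f = \<lambda>\<^sub>1 f\<close>, \<open>D2 f = \<lambda>\<^sub>2 f\<close>: comparing Taylor coefficients there, all derivatives of
  \<open>f\<close> at the vertex are \<open>f(1, 0)\<close> times polynomials in \<open>\<lambda>\<^sub>1, \<lambda>\<^sub>2\<close> that do not depend on \<open>f\<close>.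
  Hence \<open>f(1, 0) \<noteq> 0\<close> for \<open>f \<noteq> 0\<close>, and evaluating \<open>D f = \<Lambda> f\<close> at the vertex exhibits \<open>\<Lambda>\<close> as one
  fixed polynomial \<open>P(\<lambda>\<^sub>1, \<lambda>\<^sub>2)\<close>. As the \<open>q\<^sub>n\<^sub>k\<close> span, \<open>D = P(D1, D2)\<close>; \<open>P\<close> is unique because the
  pairs \<open>(\<lambda>\<^sub>1, \<lambda>\<^sub>2)\<close> are Zariski dense.
\<close>

subsection \<open>Polynomials and linear operators\<close>

lemma biconst_0 [simp]: "biconst 0 = 0"
  and biconst_1 [simp]: "biconst 1 = 1"
  and biconst_add: "biconst (a + b) = biconst a + biconst b"
  and biconst_mult: "biconst (a * b) = biconst a * biconst b"
  and biconst_minus: "biconst (- a) = - biconst a"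
  and biconst_diff: "biconst (a - b) = biconst a - biconst b"
  by (simp_all add: biconst_def one_pCons)

lemma biconst_sum: "biconst (sum h S) = (\<Sum>i\<in>S. biconst (h i))"
  by (induction S rule: infinite_finite_induct) (simp_all add: biconst_add)

lemma biconst_of_nat: "biconst (of_nat n) = of_nat n"
  by (induction n) (simp_all add: biconst_add)

lemma biconst_numeral: "biconst (numeral n) = numeral n"
  using biconst_of_nat[of "numeral n"] by simp

lemma bieval_simps [simp]:
  "bieval (biconst c) x y = c" "bieval var1 x y = x" "bieval var2 x y = y"
  "bieval 0 x y = 0" "bieval 1 x y = 1"
  "bieval (p + q) x y = bieval p x y + bieval q x y"
  "bieval (p - q) x y = bieval p x y - bieval q x y"
  "bieval (- p) x y = - bieval p x y"
  "bieval (p * q) x y = bieval p x y * bieval q x y"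
  by (simp_all add: bieval_def biconst_def var1_def var2_def)

lemma bieval_power [simp]: "bieval (p ^ n) x y = bieval p x y ^ n"
  by (induction n) simp_all

lemma bieval_of_nat [simp]: "bieval (of_nat n) x y = of_nat n"
  by (induction n) simp_all

lemma bieval_numeral [simp]: "bieval (numeral n) x y = numeral n"
  using bieval_of_nat[of "numeral n"] by simp

lemma bieval_sum [simp]: "bieval (sum f S) x y = (\<Sum>i\<in>S. bieval (f i) x y)"
  by (induction S rule: infinite_finite_induct) simp_all

text \<open>A nonzero \<open>f\<close>, read as a polynomial in the second variable, has only
  finitely many roots of the form \<open>[:v:]\<close>; at any other \<open>v\<close> a nonzero
  univariate polynomial remains, again with finitely many zeros. \<open>U\<close> may depend on
  \<open>v\<close> because the zero sets met later, a curved region and the set of eigenvalue pairs,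
  are not given as products.\<close>

lemma bipoly_eq_0I:
  assumes "infinite V" and "\<And>v. v \<in> V \<Longrightarrow> \<exists>U. infinite U \<and> (\<forall>u\<in>U. bieval f u v = 0)"
  shows "f = 0"
proof (rule ccontr)
  assume "f \<noteq> 0"
  have "poly f [:v:] = 0" if "v \<in> V" for v
  proof (rule ccontr)
    assume "poly f [:v:] \<noteq> 0"
    then have fin: "finite {u. poly (poly f [:v:]) u = 0}" by (rule poly_roots_finite)
    obtain U where "infinite U" "\<forall>u\<in>U. bieval f u v = 0" using assms(2) \<open>v \<in> V\<close> by blast
    moreover from this have "U \<subseteq> {u. poly (poly f [:v:]) u = 0}" by (auto simp: bieval_def)
    ultimately show False using fin finite_subset by blast
  qed
  then have "(\<lambda>v. [:v:]) ` V \<subseteq> {x. poly f x = 0}" by auto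
  moreover have "infinite ((\<lambda>v::real. [:v:]) ` V)"
    using assms(1) by (subst finite_image_iff) (auto simp: inj_on_def)
  ultimately show False using poly_roots_finite[OF \<open>f \<noteq> 0\<close>] finite_subset by blast
qed

lemma bipoly_eqI:
  assumes "\<And>x y. bieval p x y = bieval q x y"
  shows "p = q"
proof -
  have "p - q = 0"
  proof (rule bipoly_eq_0I[OF infinite_UNIV_char_0])
    show "\<exists>U. infinite U \<and> (\<forall>u\<in>U. bieval (p - q) u v = 0)" for v
      by (rule exI[of _ UNIV]) (simp add: assms infinite_UNIV_char_0)
  qed
  then show ?thesis by simp
qed

definition mon :: "nat \<times> nat \<Rightarrow> bipoly" where
  "mon z = var1 ^ fst z * var2 ^ snd z"

lemma mon_mult: "mon z * mon w = mon (fst z + fst w, snd z + snd w)"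
  by (simp add: mon_def power_add mult_ac)

lemma bieval_mon [simp]: "bieval (mon z) x y = x ^ fst z * y ^ snd z"
  by (simp add: mon_def)

lemma bieval_sym_monom [simp]: "bieval (sym_monom z) x y = (x + y) ^ fst z * (x * y) ^ snd z"
  by (simp add: sym_monom_def split_beta)

lemma bieval_altdef:
  "bieval f x y = (\<Sum>j\<le>degree f. \<Sum>i\<le>degree (coeff f j). coeff (coeff f j) i * (x ^ i * y ^ j))"
proof -
  have "bieval f x y = (\<Sum>j\<le>degree f. poly (coeff f j * [:y:] ^ j) x)"
    by (simp only: bieval_def poly_altdef[of f] poly_sum)
  also have "\<dots> = (\<Sum>j\<le>degree f. poly (coeff f j) x * y ^ j)"
    by simp
  also have "\<dots> = (\<Sum>j\<le>degree f. \<Sum>i\<le>degree (coeff f j). coeff (coeff f j) i * (x ^ i * y ^ j))"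
    by (simp only: poly_altdef sum_distrib_right mult.assoc)
  finally show ?thesis .
qed

lemma bipoly_expand:
  "f = (\<Sum>j\<le>degree f. \<Sum>i\<le>degree (coeff f j). biconst (coeff (coeff f j) i) * mon (i, j))"
  (is "f = ?g")
proof (rule bipoly_eqI)
  show "bieval f x y = bieval ?g x y" for x y
    unfolding bieval_altdef[of f] by simp
qed

lemma bipoly_induct [case_names add const_mon]:
  assumes add: "\<And>f g. P f \<Longrightarrow> P g \<Longrightarrow> P (f + g)" and mon: "\<And>c z. P (biconst c * mon z)"
  shows "P f"
proof -
  have 0: "P 0" using mon[of 0] by simp
  have sum: "P (sum h S)" if h: "\<And>i. P (h i)" for h :: "nat \<Rightarrow> bipoly" and S
  proof (induction S rule: infinite_finite_induct)
    case (insert x F)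
    then show ?case using add[OF h[of x]] by simp
  qed (simp_all add: 0)
  let ?g = "\<Sum>j\<le>degree f. \<Sum>i\<le>degree (coeff f j). biconst (coeff (coeff f j) i) * mon (i, j)"
  have "f = ?g" by (rule bipoly_expand)
  moreover have "P ?g" by (rule sum, rule sum, rule mon)
  ultimately show ?thesis by (rule ssubst)
qed

text \<open>Linearity over the reals of a map on \<open>bipoly\<close>, not bilinearity; a scalar
  acts as the product with a constant polynomial.\<close>

definition bilin :: "(bipoly \<Rightarrow> bipoly) \<Rightarrow> bool" where
  "bilin T \<longleftrightarrow> (\<forall>f g. T (f + g) = T f + T g) \<and> (\<forall>c f. T (biconst c * f) = biconst c * T f)"

lemma bilin_add: "bilin T \<Longrightarrow> T (f + g) = T f + T g"
  and bilin_scale: "bilin T \<Longrightarrow> T (biconst c * f) = biconst c * T f"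
  by (auto simp: bilin_def)

lemma bilin_0: "bilin T \<Longrightarrow> T 0 = 0"
  using bilin_scale[of T 0 0] by simp

lemma bilin_diff: "bilin T \<Longrightarrow> T (f - g) = T f - T g"
  using bilin_add[of T f "biconst (-1) * g"] bilin_scale[of T "-1" g] by (simp add: biconst_minus)

lemma bilin_sum: "bilin T \<Longrightarrow> T (sum f S) = (\<Sum>i\<in>S. T (f i))"
  by (induction S rule: infinite_finite_induct) (simp_all add: bilin_0 bilin_add)

lemma bilin_comp: "bilin S \<Longrightarrow> bilin T \<Longrightarrow> bilin (\<lambda>f. S (T f))"
  by (simp add: bilin_def)

lemma bilin_funpow: "bilin T \<Longrightarrow> bilin (T ^^ n)"
  by (induction n) (auto simp: bilin_def)

lemma bilin_times: "bilin T \<Longrightarrow> bilin (\<lambda>f. a * T f)"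
  by (simp add: bilin_def distrib_left mult.left_commute)

lemma bilin_plus: "bilin S \<Longrightarrow> bilin T \<Longrightarrow> bilin (\<lambda>f. S f + T f)"
  by (simp add: bilin_def distrib_left)

lemma bilin_Sum: "(\<And>i. i \<in> I \<Longrightarrow> bilin (T i)) \<Longrightarrow> bilin (\<lambda>f. \<Sum>i\<in>I. T i f)"
  by (simp add: bilin_def sum.distrib sum_distrib_left)

section \<open>Partial derivatives as commuting derivations\<close>

lemma du_add: "du (f + g) = du f + du g"
  by (rule poly_eqI) (simp add: du_def coeff_map_poly pderiv_add)

lemma du_pCons: "du (pCons a p) = pCons (pderiv a) (du p)"
  by (simp add: du_def map_poly_pCons)

lemma du_smult: "du (smult a p) = smult (pderiv a) p + smult a (du p)"
  by (rule poly_eqI) (simp add: du_def coeff_map_poly pderiv_mult mult.commute)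

lemma du_0 [simp]: "du 0 = 0"
  by (simp add: du_def)

lemma du_const [simp]: "du (biconst c) = 0"
  by (simp add: biconst_def du_pCons)

lemma du_mult: "du (f * g) = du f * g + f * du g"
proof (induction f)
  case (pCons a p)
  have "pCons 0 (du p * g + p * du g) = pCons 0 (du p * g) + pCons 0 (p * du g)" by simp
  then show ?case
    by (simp only: mult_pCons_left du_add du_smult du_pCons pCons.IH pderiv_0 add_ac)
qed simp

lemma dv_add: "dv (f + g) = dv f + dv g"
  and dv_mult: "dv (f * g) = dv f * g + f * dv g"
  and dv_const [simp]: "dv (biconst c) = 0"
  and dv_var1 [simp]: "dv var1 = 0"
  and dv_var2 [simp]: "dv var2 = 1"
  by (simp_all add: dv_def pderiv_add pderiv_mult biconst_def var1_def var2_def pderiv_pCons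
      one_pCons)

lemma du_var1 [simp]: "du var1 = 1" and du_var2 [simp]: "du var2 = 0"
  by (simp_all add: var1_def var2_def du_pCons pderiv_pCons one_pCons)

lemma du_1 [simp]: "du 1 = 0" and dv_1 [simp]: "dv 1 = 0"
  using du_const[of 1] dv_const[of 1] by (simp_all del: du_const dv_const)

lemma bilin_du: "bilin du" and bilin_dv: "bilin dv"
  by (auto simp: bilin_def du_add dv_add du_mult dv_mult)

lemma du_dv: "du (dv f) = dv (du f)"
proof (rule poly_eqI)
  fix n
  have "pderiv (of_nat m * c) = of_nat m * pderiv c" for m and c :: "real poly"
    by (simp add: pderiv_mult)
  then show "coeff (du (dv f)) n = coeff (dv (du f)) n"
    by (simp only: du_def dv_def coeff_map_poly pderiv_0 coeff_pderiv)
qed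

lemma bilin_linear_pdo:
  assumes "linear_pdo D"
  shows "bilin D"
proof -
  obtain a where a: "finite {(r, s). a r s \<noteq> 0}"
    "\<And>f. D f = (\<Sum>(r, s) \<in> {(r, s). a r s \<noteq> 0}. a r s * (du ^^ r) ((dv ^^ s) f))"
    using assms unfolding linear_pdo_def by blast
  have "D = (\<lambda>f. \<Sum>z \<in> {(r, s). a r s \<noteq> 0}. a (fst z) (snd z) * (du ^^ fst z) ((dv ^^ snd z) f))"
    by (rule ext) (simp add: a(2) split_beta)
  moreover have "bilin \<dots>"
    by (intro bilin_Sum bilin_times bilin_comp[OF bilin_funpow bilin_funpow] bilin_du bilin_dv)
  ultimately show ?thesis by simp
qed

lemma bilin_D1: "bilin (D1 \<alpha> \<gamma> \<kappa>)"
  unfolding D1_def[abs_def] Let_def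
  by (intro bilin_plus bilin_times bilin_comp[OF bilin_du bilin_du] bilin_comp[OF bilin_du bilin_dv]
      bilin_comp[OF bilin_dv bilin_dv] bilin_du bilin_dv)

lemma bilin_D2: "bilin (D2 \<alpha> \<kappa>)"
  unfolding D2_def[abs_def] Let_def
  by (intro bilin_plus bilin_times bilin_comp[OF bilin_dv bilin_dv] bilin_dv)

lemma bilin_poly_op:
  assumes "bilin A" "bilin B"
  shows "bilin (poly_op P A B)"
  unfolding poly_op_def[abs_def]
  by (intro bilin_Sum bilin_times bilin_comp[OF bilin_funpow bilin_funpow] assms)

section \<open>Polynomials of operators on joint eigenvectors\<close>

lemma funpow_eigen:
  assumes "bilin T" "T q = biconst c * q"
  shows "(T ^^ n) q = biconst (c ^ n) * q"
  by (induction n)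
    (simp_all add: bilin_scale[OF assms(1)] assms(2) biconst_mult mult.assoc mult.left_commute)

lemma poly_op_eigen:
  assumes "bilin A" "bilin B" "A q = biconst a * q" "B q = biconst b * q"
  shows "poly_op P A B q = biconst (bieval P a b) * q"
  by (simp add: poly_op_def funpow_eigen[OF assms(2,4)] bilin_scale[OF bilin_funpow[OF assms(1)]]
      funpow_eigen[OF assms(1,3)] bieval_altdef biconst_sum biconst_mult sum_distrib_right
      mult.assoc mult.left_commute)

subsection \<open>Taylor coefficients at a vertex\<close>

text \<open>Taylor coefficients without the factorials. At (1, 0) all second-order coefficients of
  \<open>D1\<close> and \<open>D2\<close> vanish, and their first-order parts become -(\<gamma> + 1)
  d/du + (\<alpha> + 1) d/dv and -(\<alpha> + 1) d/dv.\<close>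

definition jet :: "nat \<Rightarrow> nat \<Rightarrow> bipoly \<Rightarrow> real" where
  "jet r s f = bieval ((du ^^ r) ((dv ^^ s) f)) 1 0"

lemma du_funpow_dv: "du ((dv ^^ s) f) = (dv ^^ s) (du f)"
  by (induction s) (simp_all add: du_dv)

lemma du_times_var1: "(du ^^ r) (var1 * g) = var1 * (du ^^ r) g + of_nat r * (du ^^ (r - 1)) g"
proof (induction r)
  case (Suc r)
  have *: "du (of_nat r * h) = of_nat r * du h" for h
    by (simp add: bilin_scale[OF bilin_du] flip: biconst_of_nat)
  have "of_nat r * du ((du ^^ (r - 1)) g) = of_nat r * (du ^^ r) g"
    by (cases r) simp_all
  then show ?case
    by (simp add: Suc.IH du_add du_mult[of var1] * algebra_simps)
qed simp

lemma dv_times_var2: "(dv ^^ s) (var2 * g) = var2 * (dv ^^ s) g + of_nat s * (dv ^^ (s - 1)) g"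
proof (induction s)
  case (Suc s)
  have *: "dv (of_nat s * h) = of_nat s * dv h" for h
    by (simp add: bilin_scale[OF bilin_dv] flip: biconst_of_nat)
  have "of_nat s * dv ((dv ^^ (s - 1)) g) = of_nat s * (dv ^^ s) g"
    by (cases s) simp_all
  then show ?case
    by (simp add: Suc.IH dv_add dv_mult[of var2] * algebra_simps)
qed simp

lemma du_times_var2: "(du ^^ r) (var2 * g) = var2 * (du ^^ r) g"
  by (induction r) (simp_all add: du_mult)

lemma dv_times_var1: "(dv ^^ s) (var1 * g) = var1 * (dv ^^ s) g"
  by (induction s) (simp_all add: dv_mult)

lemma jet_add: "jet r s (f + g) = jet r s f + jet r s g"
  by (simp add: jet_def bilin_add[OF bilin_funpow[OF bilin_dv]] bilin_add[OF bilin_funpow[OF bilin_du]])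

lemma jet_scale: "jet r s (biconst c * f) = c * jet r s f"
  by (simp add: jet_def bilin_scale[OF bilin_funpow[OF bilin_dv]] bilin_scale[OF bilin_funpow[OF bilin_du]])

text \<open>Leibniz rule for a linear factor, with \<open>u = 1\<close> inserted. At
  \<open>r = 0\<close> the truncated index \<open>r - 1\<close> does no harm, its coefficient being
  zero; the same holds for the shifted indices in the rules below.\<close>

lemma jet_var1: "jet r s (var1 * g) = jet r s g + r * jet (r - 1) s g"
  by (simp add: jet_def dv_times_var1 du_times_var1)

text \<open>As \<open>v = 0\<close> at the base point, only the terms survive in which one
  derivative falls on the factor \<open>v\<close>. In particular multiples of \<open>v\<close> are
  invisible at \<open>s = 0\<close>.\<close>

lemma jet_var2: "jet r s (var2 * g) = s * jet r (s - 1) g"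
proof -
  have "(du ^^ r) (of_nat s * h) = of_nat s * (du ^^ r) h" for h
    by (simp add: bilin_scale[OF bilin_funpow[OF bilin_du]] flip: biconst_of_nat)
  then show ?thesis
    by (simp add: jet_def dv_times_var2 du_times_var2 bilin_add[OF bilin_funpow[OF bilin_du]])
qed

lemma jet_du: "jet r s (du g) = jet (Suc r) s g"
  by (simp add: jet_def funpow_Suc_right du_funpow_dv del: funpow.simps)

lemma jet_dv: "jet r s (dv g) = jet r (Suc s) g"
  by (simp add: jet_def funpow_Suc_right del: funpow.simps)

lemma jet_var2_dv: "jet r s (var2 * dv g) = s * jet r s g"
  by (cases s) (simp_all add: jet_var2 jet_dv)

lemma jet_var2_var2_dv_dv: "jet r s (var2 * (var2 * dv (dv g))) = s * (real s - 1) * jet r s g"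
  by (cases s; cases "s - 1") (simp_all add: jet_var2 jet_dv)

lemma jet_var1_var1:
  "jet r s (var1 * (var1 * g))
    = jet r s g + 2 * r * jet (r - 1) s g + r * (real r - 1) * jet (r - 2) s g"
  by (cases r) (simp_all add: jet_var1 algebra_simps numeral_2_eq_2)

text \<open>Take the jet of both sides of the eigenvalue equation. The factor
  \<open>s + \<alpha> + 1\<close> collects \<open>s\<close> from the second-order term and
  \<open>\<alpha> + 1\<close> from the first-order one; where it is nonzero, the jet at (r, s + 1)
  is determined by the jet at (r, s) and by rows of smaller \<open>r\<close>.\<close>

lemma D2_recurrence:
  assumes "D2 \<alpha> \<kappa> f = biconst l * f"
  shows "(s + \<alpha> + 1) * jet r (Suc s) f
    = (4 * s * (s - 1) + 4 * (\<alpha> + \<kappa> + 2) * s - l) * jet r s f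
      - (s + \<alpha> + 1) * (2 * (r * jet (r - 1) (Suc s) f) + (r - 1) * (r * jet (r - 2) (Suc s) f))"
proof -
  have "D2 \<alpha> \<kappa> f = biconst (-1) * (var1 * (var1 * (var2 * dv (dv f))))
      + (biconst 4 * (var2 * (var2 * dv (dv f)))
      + (biconst (- (\<alpha> + 1)) * (var1 * (var1 * dv f)) + biconst (4 * (\<alpha> + \<kappa> + 2)) * (var2 * dv f)))"
    by (simp add: D2_def Let_def biconst_minus biconst_diff biconst_add biconst_mult biconst_numeral
        power2_eq_square algebra_simps)
  then have "l * jet r s f = jet r s (biconst (-1) * (var1 * (var1 * (var2 * dv (dv f))))
      + (biconst 4 * (var2 * (var2 * dv (dv f)))
      + (biconst (- (\<alpha> + 1)) * (var1 * (var1 * dv f)) + biconst (4 * (\<alpha> + \<kappa> + 2)) * (var2 * dv f))))"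
    using assms by (metis jet_scale)
  then show ?thesis
    by (simp only: jet_add jet_scale jet_var1_var1 jet_var2_dv jet_var2_var2_dv_dv jet_dv)
      (simp add: algebra_simps)
qed

text \<open>On the line \<open>s = 0\<close> the first operator steps from \<open>r\<close> to
  \<open>r + 1\<close>: the difference between multiplying by \<open>u\<close> and by
  \<open>u\<^sup>2\<close> removes the derivative of order \<open>r + 2\<close>, and the first-order
  term supplies the rest of the factor \<open>r + \<gamma> + 1\<close>.\<close>

lemma D1_recurrence:
  assumes "D1 \<alpha> \<gamma> \<kappa> f = biconst l * f"
  shows "(r + \<gamma> + 1) * jet (Suc r) 0 f
    = - (r * (r - 1) + (2 * \<alpha> + 2 * \<kappa> + \<gamma> + 4) * r + l) * jet r 0 f
      + (\<alpha> + 1) * (jet r 1 f + r * jet (r - 1) 1 f)"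
proof -
  define a where "a = 2 * \<alpha> + 2 * \<kappa> + 3"
  \<comment> \<open>\<open>h\<close> gathers every term of the operator with a factor
    \<open>v\<close>; none of them contributes to a jet with \<open>s = 0\<close>.\<close>
  define h where "h = biconst 4 * du (dv f) + biconst (-4) * (var1 * du (dv f)) + var1 * dv (dv f)
    + biconst (-4) * (var2 * dv (dv f)) + biconst (- 2 * (2 * \<alpha> + 2 * \<kappa> + \<gamma> + 5)) * dv f"
  have "D1 \<alpha> \<gamma> \<kappa> f = var1 * du (du f) + (biconst (-1) * (var1 * (var1 * du (du f)))
      + (biconst a * du f + (biconst (- (a + \<gamma> + 1)) * (var1 * du f)
      + (biconst (\<alpha> + 1) * (var1 * dv f) + var2 * h))))"
    by (simp add: D1_def Let_def biconst_minus biconst_diff biconst_add biconst_mult biconst_numeral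
        biconst_diff h_def a_def algebra_simps)
  then have "l * jet r 0 f = jet r 0 (var1 * du (du f) + (biconst (-1) * (var1 * (var1 * du (du f)))
      + (biconst a * du f + (biconst (- (a + \<gamma> + 1)) * (var1 * du f)
      + (biconst (\<alpha> + 1) * (var1 * dv f) + var2 * h)))))"
    using assms by (metis jet_scale)
  then show ?thesis
    by (simp only: jet_add jet_scale jet_var1_var1 jet_var1 jet_var2 jet_du jet_dv)
      (cases r; cases "r - 1"; simp add: a_def algebra_simps)
qed

text \<open>The recurrences fill the table of jets row by row: \<open>D1_recurrence\<close> gives
  the first entry of row \<open>r\<close> from earlier rows, \<open>D2_recurrence\<close> then runs
  along the row. Both divisors are positive for \<alpha>, \<gamma> > -1, and the eigenvalues enter
  only polynomially.\<close>

lemma jet_eigenfunction: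
  assumes "\<alpha> > -1" and "\<gamma> > -1"
  shows "\<exists>P. \<forall>f l1 l2. D1 \<alpha> \<gamma> \<kappa> f = biconst l1 * f \<longrightarrow> D2 \<alpha> \<kappa> f = biconst l2 * f \<longrightarrow>
    jet r s f = bieval P l1 l2 * jet 0 0 f"
    (is "\<exists>P. ?Q r s P")
proof (induction r arbitrary: s rule: less_induct)
  case (less r)
  note outer = less.IH
  show ?case
  proof (induction s)
    case 0
    show ?case
    proof (cases r)
      case 0
      then show ?thesis by (intro exI[of _ 1]) simp
    next
      case (Suc t)
      have lt: "t < r" "t - 1 < r" using Suc by auto
      obtain P0 where P0: "?Q t 0 P0" using outer[OF lt(1), of 0] ..
      obtain P1 where P1: "?Q t 1 P1" using outer[OF lt(1), of 1] ..
      obtain P2 where P2: "?Q (t - 1) 1 P2" using outer[OF lt(2), of 1] ..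
      \<comment> \<open>This is \<open>D1_recurrence\<close> at \<open>t\<close>, solved for its
        left-hand jet, with \<open>var1\<close> standing for the eigenvalue of the first
        operator.\<close>
      define P where "P = biconst (1 / (t + \<gamma> + 1)) *
        (biconst (\<alpha> + 1) * (P1 + biconst t * P2)
          - (biconst (t * (real t - 1) + (2 * \<alpha> + 2 * \<kappa> + \<gamma> + 4) * t) + var1) * P0)"
      have "?Q r 0 P"
      proof (intro allI impI)
        fix f l1 l2
        assume f: "D1 \<alpha> \<gamma> \<kappa> f = biconst l1 * f" "D2 \<alpha> \<kappa> f = biconst l2 * f"
        have nz: "t + \<gamma> + 1 \<noteq> 0" using assms by linarith
        have J: "jet t 0 f = bieval P0 l1 l2 * jet 0 0 f"
          "jet t 1 f = bieval P1 l1 l2 * jet 0 0 f"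
          "jet (t - 1) 1 f = bieval P2 l1 l2 * jet 0 0 f"
          using P0 P1 P2 f by blast+
        have "(t + \<gamma> + 1) * bieval P l1 l2 = (\<alpha> + 1) * (bieval P1 l1 l2 + t * bieval P2 l1 l2)
          - (t * (real t - 1) + (2 * \<alpha> + 2 * \<kappa> + \<gamma> + 4) * t + l1) * bieval P0 l1 l2"
          using nz by (simp add: P_def)
        then have "(t + \<gamma> + 1) * (bieval P l1 l2 * jet 0 0 f) = (t + \<gamma> + 1) * jet r 0 f"
          unfolding Suc D1_recurrence[OF f(1), of t] J by (simp only: mult.assoc[symmetric])
            (simp add: algebra_simps)
        then show "jet r 0 f = bieval P l1 l2 * jet 0 0 f" using nz by simp
      qed
      then show ?thesis ..
    qed
  next
    case (Suc s)
    then obtain P0 where P0: "?Q r s P0" ..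
    \<comment> \<open>In row 0 there are no earlier rows; \<open>P1\<close> and \<open>P2\<close>
      are then arbitrary, since both enter with a factor \<open>r\<close>.\<close>
    obtain P1 where P1: "r \<noteq> 0 \<Longrightarrow> ?Q (r - 1) (Suc s) P1"
      by (cases "r = 0") (use outer[of "r - 1" "Suc s"] in auto)
    obtain P2 where P2: "r \<noteq> 0 \<Longrightarrow> ?Q (r - 2) (Suc s) P2"
      by (cases "r = 0") (use outer[of "r - 2" "Suc s"] in auto)
    define P where "P = biconst (1 / (s + \<alpha> + 1)) *
        ((biconst (4 * s * (real s - 1) + 4 * (\<alpha> + \<kappa> + 2) * s) - var2) * P0)
        - (biconst (2 * r) * P1 + biconst ((real r - 1) * r) * P2)"
    have "?Q r (Suc s) P"
    proof (intro allI impI)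
      fix f l1 l2
      assume f: "D1 \<alpha> \<gamma> \<kappa> f = biconst l1 * f" "D2 \<alpha> \<kappa> f = biconst l2 * f"
      have nz: "s + \<alpha> + 1 \<noteq> 0" using assms by linarith
      have J: "jet r s f = bieval P0 l1 l2 * jet 0 0 f"
        "r * jet (r - 1) (Suc s) f = r * bieval P1 l1 l2 * jet 0 0 f"
        "r * jet (r - 2) (Suc s) f = r * bieval P2 l1 l2 * jet 0 0 f"
        using P0 P1 P2 f by (cases "r = 0"; simp)+
      have "(s + \<alpha> + 1) * bieval P l1 l2
        = (4 * s * (real s - 1) + 4 * (\<alpha> + \<kappa> + 2) * s - l2) * bieval P0 l1 l2
          - (s + \<alpha> + 1) * (2 * r * bieval P1 l1 l2 + (real r - 1) * r * bieval P2 l1 l2)"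
        using nz by (simp add: P_def right_diff_distrib)
      then have "(s + \<alpha> + 1) * (bieval P l1 l2 * jet 0 0 f) = (s + \<alpha> + 1) * jet r (Suc s) f"
        unfolding D2_recurrence[OF f(2), of s r] J by (simp only: mult.assoc[symmetric])
          (simp add: algebra_simps)
      then show "jet r (Suc s) f = bieval P l1 l2 * jet 0 0 f" using nz by simp
    qed
    then show ?case ..
  qed
qed

text \<open>The jets of \<open>dv f\<close> are among those of \<open>f\<close> and its degree is
  smaller, so by induction \<open>f\<close> is free of \<open>v\<close>. The same argument in
  \<open>u\<close> then leaves a constant, which is its own jet of order 0.\<close>

lemma jet_eq_0:
  assumes "\<And>r s. jet r s f = 0"
  shows "f = 0"
  using assms
proof (induction "degree f" arbitrary: f rule: less_induct)
  case less
  have "dv f = 0"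
  proof (cases "degree f = 0")
    case False
    have "jet r s (dv f) = 0" for r s using less.prems[of r "Suc s"] by (simp add: jet_dv)
    then show ?thesis using less.hyps[of "dv f"] False by (simp add: dv_def degree_pderiv)
  qed (simp add: dv_def pderiv_eq_0_iff)
  then have "degree f = 0" by (simp add: dv_def pderiv_eq_0_iff)
  then obtain p where f: "f = [:p:]" by (rule degree_eq_zeroE)
  have d: "(du ^^ r) [:p:] = [:(pderiv ^^ r) p:]" for r
    by (induction r) (simp_all add: du_pCons)
  have "poly ((pderiv ^^ r) p) 1 = 0" for r
    using less.prems[of r 0] by (simp add: jet_def f d bieval_def)
  then have "p = 0"
  proof (induction "degree p" arbitrary: p rule: less_induct)
    case less
    have "pderiv p = 0"
    proof (cases "degree p = 0")
      case False
      have "poly ((pderiv ^^ r) (pderiv p)) 1 = 0" for r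
        using less.prems[of "Suc r"] by (simp add: funpow_Suc_right del: funpow.simps)
      then show ?thesis using less.hyps[of "pderiv p"] False by (simp add: degree_pderiv)
    qed (simp add: pderiv_eq_0_iff)
    then obtain c where "p = [:c:]" using pderiv_iszero by blast
    then show ?case using less.prems[of 0] by simp
  qed
  then show ?case by (simp add: f)
qed

lemma eigenvalue_polynomial:
  assumes "\<alpha> > -1" and "\<gamma> > -1" and "linear_pdo D"
  shows "\<exists>P. \<forall>f l1 l2 l. D1 \<alpha> \<gamma> \<kappa> f = biconst l1 * f \<longrightarrow> D2 \<alpha> \<kappa> f = biconst l2 * f \<longrightarrow>
    D f = biconst l * f \<longrightarrow> f \<noteq> 0 \<longrightarrow> l = bieval P l1 l2"
proof -
  define ok where "ok f l1 l2 \<longleftrightarrow> D1 \<alpha> \<gamma> \<kappa> f = biconst l1 * f \<and> D2 \<alpha> \<kappa> f = biconst l2 * f"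
    for f l1 l2
  obtain Q where Q: "\<And>r s f l1 l2. ok f l1 l2 \<Longrightarrow> jet r s f = bieval (Q r s) l1 l2 * jet 0 0 f"
    using jet_eigenfunction[OF assms(1,2), of \<kappa>] unfolding ok_def by metis
  obtain a where "\<And>f. D f = (\<Sum>(r, s) \<in> {(r, s). a r s \<noteq> 0}. a r s * (du ^^ r) ((dv ^^ s) f))"
    using assms(3) unfolding linear_pdo_def by blast
  then have D: "bieval (D f) 1 0
      = (\<Sum>z \<in> {(r, s). a r s \<noteq> 0}. bieval (a (fst z) (snd z)) 1 0 * jet (fst z) (snd z) f)" for f
    by (simp add: jet_def split_beta)
  \<comment> \<open>The value of \<open>D f\<close> at the vertex is a fixed combination of jets of
    \<open>f\<close>; replacing each jet by its polynomial \<open>Q r s\<close> leaves the common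
    factor \<open>jet 0 0 f\<close>.\<close>
  define P where "P = (\<Sum>z \<in> {(r, s). a r s \<noteq> 0}.
      biconst (bieval (a (fst z) (snd z)) 1 0) * Q (fst z) (snd z))"
  have "l = bieval P l1 l2" if ok: "ok f l1 l2" and l: "D f = biconst l * f" and "f \<noteq> 0" for f l1 l2 l
  proof -
    have "l * jet 0 0 f = bieval (D f) 1 0" by (simp add: l jet_def)
    also have "\<dots> = (\<Sum>z \<in> {(r, s). a r s \<noteq> 0}.
        bieval (a (fst z) (snd z)) 1 0 * (bieval (Q (fst z) (snd z)) l1 l2 * jet 0 0 f))"
      unfolding D by (intro sum.cong refl arg_cong2[where f = "(*)"] Q[OF ok])
    also have "\<dots> = bieval P l1 l2 * jet 0 0 f"
      by (simp add: P_def sum_distrib_right mult.assoc)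
    finally have "l * jet 0 0 f = bieval P l1 l2 * jet 0 0 f" .
    moreover have "jet 0 0 f \<noteq> 0"
    proof
      assume "jet 0 0 f = 0"
      then have "jet r s f = 0" for r s using Q[OF ok, of r s] by simp
      then show False using jet_eq_0 \<open>f \<noteq> 0\<close> by blast
    qed
    ultimately show ?thesis by simp
  qed
  then show ?thesis unfolding ok_def by blast
qed

subsection \<open>Moments\<close>

lemma nn_integral_Beta:
  assumes "a > 0" "b > (0::real)"
  shows "(\<integral>\<^sup>+t. ennreal (t powr (a - 1) * (1 - t) powr (b - 1)) * indicator {0..1} t \<partial>lborel) = ennreal (Beta a b)"
  by (rule nn_integral_has_integral_lebesgue'[OF _ has_integral_Beta_real[OF assms]]) simp

lemma power2_powr: "0 \<le> x \<Longrightarrow> (x\<^sup>2) powr a = x powr (2 * a)" for x :: real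
  by (cases "x = 0") (simp_all add: powr_powr flip: powr_numeral)

text \<open>The substitution \<open>t = 4 v / u\<^sup>2\<close>, with \<open>v = x y\<close> and \<open>u = x + y\<close>, turns the
  integral over an antidiagonal into a Beta integral.\<close>

lemma nn_integral_antidiagonal:
  assumes u: "u > 0" and p: "p > -1" and \<kappa>: "\<kappa> > (-1::real)"
  shows "(\<integral>\<^sup>+y. ennreal ((y * (u - y)) powr p * (u - 2 * y) powr (2 * \<kappa> + 1)) * indicator {0..u / 2} y \<partial>lborel)
    = ennreal ((1 / 4) powr (p + 1) * u powr (2 * p + 2 * \<kappa> + 2) * Beta (p + 1) (\<kappa> + 1))"
proof -
  define C where "C = (1 / 4) powr (p + 1) * u powr (2 * p + 2 * \<kappa> + 2)"
  \<comment> \<open>Here \<open>g\<close> is the substitution, increasing from 0 to 1 on the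
    interval, and \<open>f\<close> is the integrand in \<open>t\<close>, written with
    \<open>y (u - y) = t u\<^sup>2 / 4\<close> and
    \<open>(u - 2 y)\<^sup>2 = u\<^sup>2 (1 - t)\<close>.\<close>
  define f where "f t = (t * (u\<^sup>2 / 4)) powr p * (u\<^sup>2 * (1 - t)) powr \<kappa> * (u\<^sup>2 / 4)" for t
  define g where "g y = 4 * y * (u - y) / u\<^sup>2" for y
  define g' where "g' y = 4 * (u - 2 * y) / u\<^sup>2" for y
  have g0: "g 0 = 0" and g1: "g (u / 2) = 1"
    using u by (simp_all add: g_def field_simps power2_eq_square)
  have [measurable]: "f \<in> borel_measurable borel" unfolding f_def by measurable
  have f: "f t = C * (t powr p * (1 - t) powr \<kappa>)" if "t \<in> {0..1}" for t
  proof -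
    have "f t = (1 / 4) powr p * (1 / 4) * ((u\<^sup>2) powr p * (u\<^sup>2) powr \<kappa> * u\<^sup>2) * (t powr p * (1 - t) powr \<kappa>)"
    proof -
      have "(u\<^sup>2 / 4) powr p = (u\<^sup>2) powr p * (1 / 4) powr p"
        using powr_mult[of "u\<^sup>2" "1 / 4" p] by simp
      moreover have "(t * (u\<^sup>2 / 4)) powr p = t powr p * (u\<^sup>2 / 4) powr p" by (rule powr_mult)
      moreover have "(u\<^sup>2 * (1 - t)) powr \<kappa> = (u\<^sup>2) powr \<kappa> * (1 - t) powr \<kappa>" by (rule powr_mult)
      ultimately show ?thesis unfolding f_def by (simp only: mult_ac times_divide_eq_right mult_1_right)
    qed
    also have "(1 / 4) powr p * (1 / 4) = (1 / 4 :: real) powr (p + 1)"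
      by (simp add: powr_add)
    also have "(u\<^sup>2) powr p * (u\<^sup>2) powr \<kappa> * u\<^sup>2 = u powr (2 * p + 2 * \<kappa> + 2)"
      using u by (simp add: power2_powr powr_add powr_numeral)
    finally show ?thesis by (simp add: C_def)
  qed
  have fg: "f (g y) * g' y = (y * (u - y)) powr p * (u - 2 * y) powr (2 * \<kappa> + 1)"
    if "y \<in> {0..u / 2}" for y
  proof -
    have "g y * (u\<^sup>2 / 4) = y * (u - y)" using u by (simp add: g_def)
    moreover have "u\<^sup>2 * (1 - g y) = (u - 2 * y)\<^sup>2"
      using u by (simp add: g_def field_simps power2_eq_square)
    moreover have "u\<^sup>2 / 4 * g' y = u - 2 * y" using u by (simp add: g'_def)
    ultimately have "f (g y) * g' y = (y * (u - y)) powr p * ((u - 2 * y)\<^sup>2 powr \<kappa> * (u - 2 * y))"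
      unfolding f_def by (simp only: mult.assoc)
    then show ?thesis using that by (cases "u = 2 * y") (simp_all add: power2_powr powr_add)
  qed
  have "(\<integral>\<^sup>+y. ennreal ((y * (u - y)) powr p * (u - 2 * y) powr (2 * \<kappa> + 1)) * indicator {0..u / 2} y \<partial>lborel)
    = (\<integral>\<^sup>+y. ennreal (f (g y)) * ennreal (g' y) * indicator {0..u / 2} y \<partial>lborel)"
  proof (intro nn_integral_cong)
    fix y
    have "f (g y) \<ge> 0" by (simp add: f_def)
    then show "ennreal ((y * (u - y)) powr p * (u - 2 * y) powr (2 * \<kappa> + 1)) * indicator {0..u / 2} y
        = ennreal (f (g y)) * ennreal (g' y) * indicator {0..u / 2} y"
      using fg[of y] by (auto simp: indicator_def simp flip: ennreal_mult')
  qed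
  also have "\<dots> = (\<integral>\<^sup>+t. ennreal (f t) * indicator {g 0..g (u / 2)} t \<partial>lborel)"
  proof (rule nn_integral_substitution_aux[symmetric])
    show "(g has_real_derivative g' y) (at y)" for y
      unfolding g_def g'_def using u by (auto intro!: derivative_eq_intros simp: field_simps)
    show "continuous_on {0..u / 2} g'" unfolding g'_def using u by (intro continuous_intros) auto
    show "g' y \<ge> 0" if "y \<in> {0..u / 2}" for y using that by (simp add: g'_def)
  qed (use u in auto)
  also have "\<dots> = (\<integral>\<^sup>+t. ennreal C * (ennreal (t powr p * (1 - t) powr \<kappa>) * indicator {0..1} t) \<partial>lborel)"
    unfolding g0 g1
    by (intro nn_integral_cong) (auto simp: f indicator_def C_def ennreal_mult' simp flip: mult.assoc)
  also have "\<dots> = ennreal C * (\<integral>\<^sup>+t. ennreal (t powr p * (1 - t) powr \<kappa>) * indicator {0..1} t \<partial>lborel)"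
    by (rule nn_integral_cmult) measurable
  also have "\<dots> = ennreal C * ennreal (Beta (p + 1) (\<kappa> + 1))"
    using nn_integral_Beta[of "p + 1" "\<kappa> + 1"] p \<kappa> by simp
  finally show ?thesis by (simp add: C_def ennreal_mult')
qed

section \<open>Measurability of the triangle and the weight\<close>

lemma triangle_sets [measurable]: "triangle \<in> sets borel"
proof -
  have "triangle = {z. 0 \<le> fst z} \<inter> {z. 0 \<le> snd z} \<inter> {z. fst z + snd z \<le> 1} \<inter> {z. snd z < fst z}"
    by (auto simp: triangle_def)
  also have "\<dots> \<in> sets borel"
    by (intro sets.Int borel_closed borel_open closed_Collect_le open_Collect_less continuous_intros)
  finally show ?thesis .
qed

lemma borel_measurable_fst_snd [measurable]:
  "fst \<in> borel_measurable (borel :: (real \<times> real) measure)"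
  "snd \<in> borel_measurable (borel :: (real \<times> real) measure)"
  by (intro borel_measurable_continuous_onI continuous_intros)+

lemma weight_measurable [measurable]:
  "(\<lambda>z. weight \<alpha> \<gamma> \<kappa> (fst z) (snd z)) \<in> borel_measurable (borel :: (real \<times> real) measure)"
  unfolding weight_def by (intro borel_measurable_times powr_real_measurable borel_measurable_diff
      borel_measurable_abs borel_measurable_const borel_measurable_fst_snd)

text \<open>The shear (x, y) to (u, y) with \<open>u = x + y\<close> preserves Lebesgue measure. By
  Tonelli the integral over \<open>y\<close> for fixed \<open>u\<close> is an antidiagonal integral,
  and a Beta integral in \<open>u\<close> remains. Its parameter \<open>e\<close> is positive for
  all \<open>n\<close> and \<open>k\<close> because \<alpha> + \<kappa> > -3/2.\<close>

lemma moment_nn_integral: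
  assumes \<alpha>: "\<alpha> > -1" and \<gamma>: "\<gamma> > -1" and \<kappa>: "\<kappa> > -1" and \<alpha>\<kappa>: "\<alpha> + \<kappa> > -3/2"
  shows "(\<integral>\<^sup>+z. ennreal (indicator triangle z *
      ((fst z + snd z) ^ n * (fst z * snd z) ^ k * weight \<alpha> \<gamma> \<kappa> (fst z) (snd z))) \<partial>lborel)
    = ennreal ((1 / 4) powr (\<alpha> + k + 1) * Beta (\<alpha> + k + 1) (\<kappa> + 1)
        * Beta (n + 2 * k + 2 * \<alpha> + 2 * \<kappa> + 3) (\<gamma> + 1))"
proof -
  define p where "p = \<alpha> + k"
  define c where "c = (1 / 4) powr (p + 1) * Beta (p + 1) (\<kappa> + 1)"
  define e where "e = n + 2 * k + 2 * \<alpha> + 2 * \<kappa> + 3"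
  have p: "p > -1" and e: "e > 0" using \<alpha> \<alpha>\<kappa> by (simp_all add: p_def e_def)
  have c: "c \<ge> 0" using p \<kappa> by (auto simp: c_def Beta_def)
  define G where "G z = ennreal (indicator triangle z *
      ((fst z + snd z) ^ n * (fst z * snd z) ^ k * weight \<alpha> \<gamma> \<kappa> (fst z) (snd z)))" for z
  have G [measurable]: "G \<in> borel_measurable borel"
    unfolding G_def by measurable
  have G' [measurable]: "G \<in> borel_measurable (lborel \<Otimes>\<^sub>M lborel)"
    using G by (simp add: lborel_prod)
  have GS: "(\<lambda>z. G (fst z - snd z, snd z)) \<in> borel_measurable (lborel \<Otimes>\<^sub>M lborel)"
    unfolding lborel_prod by measurable
  have shear: "G (u - y, y) = ennreal (u ^ n * (1 - u) powr \<gamma>) * indicator {0..1} u *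
      (ennreal ((y * (u - y)) powr p * (u - 2 * y) powr (2 * \<kappa> + 1)) * indicator {0..u / 2} y)" for u y
  proof (cases "0 \<le> y \<and> 2 * y < u \<and> u \<le> 1")
    case True
    have "(y * (u - y)) ^ k * (y * (u - y)) powr \<alpha> = (y * (u - y)) powr p"
      using True by (cases "y = 0") (simp_all add: p_def powr_add powr_realpow mult.commute)
    then show ?thesis
      using True by (simp add: G_def triangle_def weight_def mult_ac flip: ennreal_mult')
  next
    case False
    \<comment> \<open>On the diagonal \<open>2 * y = u\<close>, outside the triangle but inside the
      closed interval, the right side also vanishes, because \<open>0 powr a = 0\<close>.\<close>
    then show ?thesis
      by (cases "2 * y = u") (auto simp: G_def triangle_def indicator_def)
  qed
  have inner: "(\<integral>\<^sup>+y. G (u - y, y) \<partial>lborel)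
      = ennreal c * (ennreal (u powr (e - 1) * (1 - u) powr (\<gamma> + 1 - 1)) * indicator {0..1} u)" for u
  proof -
    let ?I = "\<integral>\<^sup>+y. ennreal ((y * (u - y)) powr p * (u - 2 * y) powr (2 * \<kappa> + 1)) * indicator {0..u / 2} y \<partial>lborel"
    have "(\<integral>\<^sup>+y. G (u - y, y) \<partial>lborel) = ennreal (u ^ n * (1 - u) powr \<gamma>) * indicator {0..1} u * ?I"
      unfolding shear by (rule nn_integral_cmult) measurable
    also have "\<dots> = ennreal c * (ennreal (u powr (e - 1) * (1 - u) powr (\<gamma> + 1 - 1)) * indicator {0..1} u)"
    proof (cases "u \<in> {0<..1}")
      case True
      then have "?I = ennreal (c * u powr (2 * p + 2 * \<kappa> + 2))"
        using nn_integral_antidiagonal[of u p \<kappa>] p \<kappa> by (simp add: c_def mult_ac)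
      moreover have "u ^ n * u powr (2 * p + 2 * \<kappa> + 2) = u powr (e - 1)"
        using True by (simp add: p_def e_def algebra_simps flip: powr_realpow powr_add)
      ultimately show ?thesis
        using True c by (simp add: mult_ac flip: ennreal_mult'')
    next
      case False
      \<comment> \<open>For \<open>u = 0\<close> and \<open>n = 0\<close> the prefactor is 1, so the
        inner integral itself has to vanish.\<close>
      have "?I = (\<integral>\<^sup>+(y :: real). 0 \<partial>lborel)" if "u = 0"
        unfolding that by (intro nn_integral_cong) (auto simp: indicator_def)
      then show ?thesis using False by (cases "u = 0") auto
    qed
    finally show ?thesis .
  qed
  have "(\<integral>\<^sup>+z. G z \<partial>lborel) = (\<integral>\<^sup>+y. \<integral>\<^sup>+x. G (x, y) \<partial>lborel \<partial>lborel)"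
    using lborel_pair.nn_integral_snd[OF G'] by (simp add: lborel_prod)
  also have "\<dots> = (\<integral>\<^sup>+y. \<integral>\<^sup>+u. G (u - y, y) \<partial>lborel \<partial>lborel)"
  proof (rule nn_integral_cong)
    fix y :: real
    have "(\<lambda>x. G (x, y)) \<in> borel_measurable borel" by measurable
    then show "(\<integral>\<^sup>+x. G (x, y) \<partial>lborel) = (\<integral>\<^sup>+u. G (u - y, y) \<partial>lborel)"
      by (subst nn_integral_real_affine[of _ 1 "- y"]) simp_all
  qed
  also have "\<dots> = (\<integral>\<^sup>+u. \<integral>\<^sup>+y. G (u - y, y) \<partial>lborel \<partial>lborel)"
    using lborel_pair.Fubini'[of "\<lambda>u y. G (u - y, y)"] GS by (simp add: case_prod_beta')
  also have "\<dots> = ennreal c * (\<integral>\<^sup>+u. ennreal (u powr (e - 1) * (1 - u) powr (\<gamma> + 1 - 1)) * indicator {0..1} u \<partial>lborel)"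
    unfolding inner by (rule nn_integral_cmult) measurable
  also have "\<dots> = ennreal c * ennreal (Beta e (\<gamma> + 1))"
    using nn_integral_Beta[of e "\<gamma> + 1"] e \<gamma> by simp
  also have "\<dots> = ennreal (c * Beta e (\<gamma> + 1))"
    using c by (simp add: ennreal_mult')
  finally show ?thesis unfolding G_def c_def e_def p_def
    by (simp only: of_nat_add of_nat_mult of_nat_numeral)
qed

subsection \<open>The monomial filtration\<close>

lemma coeff_mon: "coeff (coeff (mon w) j) i = (if w = (i, j) then 1 else 0)"
proof -
  have "mon w = monom (monom 1 (fst w)) (snd w)"
  proof (rule bipoly_eqI)
    show "bieval (mon w) x y = bieval (monom (monom 1 (fst w)) (snd w)) x y" for x y
      unfolding bieval_mon by (simp add: bieval_def poly_monom)
  qed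
  then show ?thesis by (auto simp: prod_eq_iff)
qed

text \<open>The span of the monomials strictly below \<open>z\<close>; thus
  \<open>q - mon z \<in> low z\<close> says that \<open>q\<close> is monic with leading monomial
  \<open>mon z\<close>.\<close>

definition low :: "nat \<times> nat \<Rightarrow> bipoly set" where
  "low z = {f. \<exists>c. f = (\<Sum>w | prec w z. biconst (c w) * mon w)}"

lemma prec_iff: "prec w z \<longleftrightarrow> fst w + 2 * snd w < fst z + 2 * snd z
    \<or> fst w + 2 * snd w = fst z + 2 * snd z \<and> snd w < snd z"
  by (simp add: prec_def split_beta)

lemma prec_trans: "prec a b \<Longrightarrow> prec b c \<Longrightarrow> prec a c"
  by (auto simp: prec_iff)

lemma finite_prec: "finite {w. prec w z}"
proof (rule finite_subset)
  show "{w. prec w z} \<subseteq> {..fst z + 2 * snd z} \<times> {..fst z + 2 * snd z}"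
    by (auto simp: prec_iff)
qed simp

text \<open>The order is lexicographic in the weighted degree, with weight 1 for \<open>u\<close>
  and 2 for \<open>v\<close>, followed by the exponent of \<open>v\<close>.\<close>

lemma wf_prec: "wf {(w, z). prec w z}"
proof -
  have "{(w, z). prec w z} = inv_image (less_than <*lex*> less_than) (\<lambda>z. (fst z + 2 * snd z, snd z))"
    by (auto simp: prec_iff)
  then show ?thesis by (simp add: wf_lex_prod)
qed

lemma low_sumI: "(\<Sum>w | prec w z. biconst (c w) * mon w) \<in> low z"
  by (auto simp: low_def)

lemma low_0: "0 \<in> low z"
  using low_sumI[of "\<lambda>_. 0" z] by simp

lemma low_add: "f \<in> low z \<Longrightarrow> g \<in> low z \<Longrightarrow> f + g \<in> low z"
  unfolding low_def by (auto simp: simp flip: sum.distrib distrib_right biconst_add)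

lemma low_scale: "f \<in> low z \<Longrightarrow> biconst a * f \<in> low z"
  unfolding low_def by (auto simp: sum_distrib_left simp flip: mult.assoc biconst_mult)

lemma low_diff: "f \<in> low z \<Longrightarrow> g \<in> low z \<Longrightarrow> f - g \<in> low z"
  using low_add[of f z "biconst (-1) * g"] low_scale[of g z "-1"] by (simp add: biconst_minus)

lemma low_mon: "prec w z \<Longrightarrow> mon w \<in> low z"
proof -
  assume w: "prec w z"
  have "(\<Sum>x | prec x z. biconst (if x = w then 1 else 0) * mon x) = mon w"
    using w finite_prec[of z] by (simp add: if_distrib[of biconst] if_distrib[of "\<lambda>x. x * _"] cong: if_cong)
  then show ?thesis by (metis low_sumI)
qed

lemma low_sum: "(\<And>i. i \<in> S \<Longrightarrow> h i \<in> low z) \<Longrightarrow> sum h S \<in> low z"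
  by (induction S rule: infinite_finite_induct) (auto intro: low_0 low_add)

lemma low_mono:
  assumes "prec w z" "f \<in> low w"
  shows "f \<in> low z"
proof -
  obtain c where c: "f = (\<Sum>x | prec x w. biconst (c x) * mon x)"
    using assms(2) by (auto simp: low_def)
  show ?thesis unfolding c
    by (intro low_sum low_scale low_mon) (auto intro: prec_trans assms(1))
qed

lemma low_map:
  assumes "bilin T" "\<And>w. prec w z \<Longrightarrow> T (mon w) \<in> low z" "f \<in> low z"
  shows "T f \<in> low z"
proof -
  obtain c where c: "f = (\<Sum>w | prec w z. biconst (c w) * mon w)"
    using assms(3) by (auto simp: low_def)
  show ?thesis
    unfolding c bilin_sum[OF assms(1)] bilin_scale[OF assms(1)]
    by (intro low_sum low_scale assms(2)) simp
qed

text \<open>Each \<open>mon z\<close> is \<open>q z\<close> up to smaller monomials, on which the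
  two maps agree by well-founded induction. Equality of operators thus needs checking only on
  orthogonal polynomials.\<close>

lemma bilin_eqI:
  assumes S: "bilin S" and T: "bilin T"
    and q: "\<And>z. q z - mon z \<in> low z" and eq: "\<And>z. S (q z) = T (q z)"
  shows "S = T"
proof
  have mon: "S (mon z) = T (mon z)" for z
  proof (induction z rule: wf_induct_rule[OF wf_prec])
    case (1 z)
    obtain c where c: "q z - mon z = (\<Sum>w | prec w z. biconst (c w) * mon w)"
      using q[of z] by (auto simp: low_def)
    have "S (q z - mon z) = T (q z - mon z)"
      unfolding c by (simp add: bilin_sum[OF S] bilin_sum[OF T] bilin_scale[OF S] bilin_scale[OF T] 1)
    then show ?case using eq[of z] by (simp add: bilin_diff[OF S] bilin_diff[OF T])
  qed
  show "S f = T f" for f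
    by (induction f rule: bipoly_induct)
      (simp_all add: bilin_add[OF S] bilin_add[OF T] bilin_scale[OF S] bilin_scale[OF T] mon)
qed

section \<open>The two operators on monomials\<close>

lemma du_mon: "du (mon z) = biconst (fst z) * mon (fst z - 1, snd z)"
proof -
  have "du (var1 ^ n) = biconst n * var1 ^ (n - 1)" for n
  proof (induction n)
    case (Suc n)
    then show ?case by (cases n) (simp_all add: du_mult biconst_add biconst_numeral algebra_simps)
  qed simp
  moreover have "du (var2 ^ k) = 0" for k by (induction k) (simp_all add: du_mult)
  ultimately show ?thesis by (simp add: mon_def du_mult)
qed

lemma dv_mon: "dv (mon z) = biconst (snd z) * mon (fst z, snd z - 1)"
proof -
  have "dv (var2 ^ n) = biconst n * var2 ^ (n - 1)" for n
  proof (induction n)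
    case (Suc n)
    then show ?case by (cases n) (simp_all add: dv_mult biconst_add biconst_numeral algebra_simps)
  qed simp
  moreover have "dv (var1 ^ k) = 0" for k by (induction k) (simp_all add: dv_mult)
  ultimately show ?thesis by (simp add: mon_def dv_mult mult.left_commute)
qed

text \<open>The first two monomials have weighted degree one less than \<open>(n, k)\<close>, so the
  operator is triangular and the last coefficient is its eigenvalue. Truncated exponents occur only
  with coefficient zero.\<close>

lemma D1_mon:
  fixes \<alpha> \<gamma> \<kappa> :: real
  defines "a \<equiv> 2 * \<alpha> + 2 * \<kappa> + 3"
  shows "D1 \<alpha> \<gamma> \<kappa> (mon (n, k))
    = biconst (n * (real n - 1 + 4 * k + a)) * mon (n - 1, k)
      + biconst (k * (k + \<alpha>)) * mon (n + 1, k - 1)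
      + biconst (- (n + 2 * k) * (n + 2 * k + a + \<gamma>)) * mon (n, k)"
  by (rule bipoly_eqI, simp only: D1_def Let_def du_mon dv_mon bilin_scale[OF bilin_du]
      bilin_scale[OF bilin_dv] prod.sel bieval_simps bieval_mon bieval_numeral)
    (cases n; cases "n - 1"; cases k; cases "k - 1"; simp add: a_def algebra_simps)

text \<open>The first monomial has the same weighted degree as \<open>(n, k)\<close>; it is smaller
  only through the tie-break on the exponent of \<open>v\<close>.\<close>

lemma D2_mon:
  "D2 \<alpha> \<kappa> (mon (n, k)) = biconst (- (k * (k + \<alpha>))) * mon (n + 2, k - 1)
      + biconst (4 * k * (k + \<alpha> + \<kappa> + 1)) * mon (n, k)"
  by (rule bipoly_eqI, simp only: D2_def Let_def dv_mon bilin_scale[OF bilin_dv] prod.sel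
      bieval_simps bieval_mon bieval_numeral bieval_power)
    (cases k; cases "k - 1"; simp add: power2_eq_square algebra_simps)

subsection \<open>Orthogonality and joint eigenfunctions\<close>

locale jacobi_triangle =
  fixes \<alpha> \<gamma> \<kappa> :: real
  assumes \<alpha>: "\<alpha> > -1" and \<gamma>: "\<gamma> > -1" and \<kappa>: "\<kappa> > -1" and \<alpha>\<kappa>: "\<alpha> + \<kappa> > -3/2"
begin

definition moment :: "nat \<Rightarrow> nat \<Rightarrow> real" where
  "moment n k = (1 / 4) powr (\<alpha> + k + 1) * Beta (\<alpha> + k + 1) (\<kappa> + 1)
        * Beta (n + 2 * k + 2 * \<alpha> + 2 * \<kappa> + 3) (\<gamma> + 1)"

definition integrand :: "bipoly \<Rightarrow> real \<times> real \<Rightarrow> real" where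
  "integrand f z = indicator triangle z *
    (bieval f (fst z + snd z) (fst z * snd z) * weight \<alpha> \<gamma> \<kappa> (fst z) (snd z))"

text \<open>The inner product of \<open>f\<close> and \<open>g\<close>, polynomials in
  \<open>u\<close> and \<open>v\<close>, is \<open>M (f * g)\<close>, with the integral pulled back
  to the triangle.\<close>

definition M :: "bipoly \<Rightarrow> real" where
  "M f = (\<integral>z. integrand f z \<partial>lborel)"

lemma moment_nonneg: "moment n k \<ge> 0"
proof -
  have "Beta (\<alpha> + k + 1) (\<kappa> + 1) \<ge> 0" "Beta (n + 2 * k + 2 * \<alpha> + 2 * \<kappa> + 3) (\<gamma> + 1) \<ge> 0"
    using \<alpha> \<gamma> \<kappa> \<alpha>\<kappa> by (auto simp: Beta_def)
  then show ?thesis by (simp add: moment_def)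
qed

lemma integrand_mon:
  "integrand (mon (n, k)) = (\<lambda>z. indicator triangle z *
      ((fst z + snd z) ^ n * (fst z * snd z) ^ k * weight \<alpha> \<gamma> \<kappa> (fst z) (snd z)))"
  by (simp add: fun_eq_iff integrand_def)

lemma integrand_mon_nonneg: "integrand (mon z) w \<ge> 0"
  by (auto simp: integrand_def weight_def triangle_def indicator_def)

lemma integrand_mon_measurable: "integrand (mon (n, k)) \<in> borel_measurable borel"
  unfolding integrand_mon by measurable

lemma integrand_add: "integrand (f + g) z = integrand f z + integrand g z"
  by (simp add: integrand_def algebra_simps)

lemma integrand_scale: "integrand (biconst c * f) z = c * integrand f z"
  by (simp add: integrand_def)

lemma integrable_integrand: "integrable lborel (integrand f)"
proof (induction f rule: bipoly_induct)
  case (add f g)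
  then show ?case using Bochner_Integration.integrable_add[OF add] by (simp add: integrand_add[abs_def])
next
  case (const_mon c z)
  obtain n k where z: "z = (n, k)" by fastforce
  have "(\<integral>\<^sup>+w. ennreal (integrand (mon z) w) \<partial>lborel) = ennreal (moment n k)"
    unfolding z integrand_mon moment_def by (rule moment_nn_integral[OF \<alpha> \<gamma> \<kappa> \<alpha>\<kappa>])
  then have "integrable lborel (integrand (mon z))"
    by (intro integrableI_nn_integral_finite[where x = "moment n k"] AE_I2 integrand_mon_nonneg)
      (simp_all add: z integrand_mon_measurable)
  then show ?case by (simp add: integrand_scale[abs_def])
qed

lemma M_add: "M (f + g) = M f + M g"
  by (simp add: M_def integrand_add integrable_integrand)

lemma M_scale: "M (biconst c * f) = c * M f"
  by (simp add: M_def integrand_scale)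

lemma M_diff: "M (f - g) = M f - M g"
  using M_add[of f "biconst (-1) * g"] M_scale[of "-1" g] by (simp add: biconst_minus)

lemma M_0: "M 0 = 0"
  using M_scale[of 0 0] by simp

lemma M_sum: "M (sum h S) = (\<Sum>i\<in>S. M (h i))"
  by (induction S rule: infinite_finite_induct) (simp_all add: M_0 M_add)

lemma M_mon: "M (mon (n, k)) = moment n k"
proof -
  have "ennreal (M (mon (n, k))) = (\<integral>\<^sup>+z. ennreal (integrand (mon (n, k)) z) \<partial>lborel)"
    unfolding M_def
    by (intro nn_integral_eq_integral[symmetric] integrable_integrand AE_I2 integrand_mon_nonneg)
  also have "\<dots> = ennreal (moment n k)"
    unfolding integrand_mon moment_def by (rule moment_nn_integral[OF \<alpha> \<gamma> \<kappa> \<alpha>\<kappa>])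
  finally have e: "ennreal (M (mon (n, k))) = ennreal (moment n k)" .
  have "M (mon (n, k)) \<ge> 0"
    unfolding M_def by (intro integral_nonneg_AE AE_I2 integrand_mon_nonneg)
  then show ?thesis using e moment_nonneg by (simp add: ennreal_inj)
qed

section \<open>Moment recurrences and symmetry of the operators\<close>

lemma moment_Suc:
  "moment (Suc n) k * (n + 2 * k + 2 * \<alpha> + 2 * \<kappa> + \<gamma> + 4) = (n + 2 * k + 2 * \<alpha> + 2 * \<kappa> + 3) * moment n k"
proof -
  define e where "e = n + 2 * k + 2 * \<alpha> + 2 * \<kappa> + 3"
  have "e > 0" using \<alpha>\<kappa> by (simp add: e_def)
  then have "e \<notin> \<int>\<^sub>\<le>\<^sub>0" by (auto elim!: nonpos_Ints_cases)
  then have "(e + (\<gamma> + 1)) * Beta (e + 1) (\<gamma> + 1) = e * Beta e (\<gamma> + 1)"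
    by (rule Beta_plus1_left)
  then have "C * Beta (e + 1) (\<gamma> + 1) * (e + (\<gamma> + 1)) = e * (C * Beta e (\<gamma> + 1))" for C
    by (simp add: mult_ac)
  from this[of "(1 / 4) powr (\<alpha> + k + 1) * Beta (\<alpha> + k + 1) (\<kappa> + 1)"]
  show ?thesis by (simp add: moment_def e_def add_ac)
qed

text \<open>Passing to \<open>n + 2\<close> on the right keeps the weighted degree, hence the Beta
  factor containing \<gamma>, equal on both sides. Only the other Beta factor changes, and 4 comes
  from the power of 1/4.\<close>

lemma moment_Suc_right:
  "moment n (Suc k) * (4 * (k + \<alpha> + \<kappa> + 2)) = (k + \<alpha> + 1) * moment (n + 2) k"
proof -
  define e where "e = \<alpha> + k + 1"
  have "e > 0" using \<alpha> by (simp add: e_def)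
  then have "e \<notin> \<int>\<^sub>\<le>\<^sub>0" by (auto elim!: nonpos_Ints_cases)
  then have B: "(e + (\<kappa> + 1)) * Beta (e + 1) (\<kappa> + 1) = e * Beta e (\<kappa> + 1)"
    by (rule Beta_plus1_left)
  define C where "C = Beta (n + 2 + 2 * k + 2 * \<alpha> + 2 * \<kappa> + 3) (\<gamma> + 1)"
  have P: "(1 / 4 :: real) powr e = (1 / 4) powr (e + 1) * 4"
    by (simp add: powr_add)
  have "(1 / 4) powr (e + 1) * Beta (e + 1) (\<kappa> + 1) * C * (4 * (e + (\<kappa> + 1)))
      = ((1 / 4) powr e * C) * ((e + (\<kappa> + 1)) * Beta (e + 1) (\<kappa> + 1))"
    unfolding P by (simp only: mult_ac)
  also have "\<dots> = e * ((1 / 4) powr e * Beta e (\<kappa> + 1) * C)"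
    unfolding B by (simp only: mult_ac)
  finally show ?thesis by (simp add: moment_def e_def C_def add_ac)
qed

text \<open>Both sides are combinations of moments near the total exponent \<open>(N, K)\<close>.
  The moment recurrences relate these, leaving a polynomial identity in the exponents.\<close>

lemma D1_symmetric_mon: "M (D1 \<alpha> \<gamma> \<kappa> (mon z) * mon w) = M (mon z * D1 \<alpha> \<gamma> \<kappa> (mon w))"
proof -
  obtain n k m l where z: "z = (n, k)" and w: "w = (m, l)" by fastforce
  define a where "a = 2 * \<alpha> + 2 * \<kappa> + 3"
  have a: "a > 0" using \<alpha>\<kappa> by (simp add: a_def)
  define N K where "N = n + m" and "K = k + l"
  define T :: real where "T = N + 2 * K"
  show ?thesis
  proof (cases "N = 0 \<and> K = 0")
    \<comment> \<open>Treated apart because \<open>T - 1 + a\<close> need not be positive at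
      \<open>T = 0\<close>.\<close>
    case True
    then show ?thesis by (simp add: z w N_def K_def mult.commute)
  next
    case False
    then have "T \<ge> 1" by (auto simp: T_def)
    then have pos: "T - 1 + a > 0" using a by simp
    \<comment> \<open>A common unit: the moments at \<open>(N, K)\<close>, at
      \<open>(N - 1, K)\<close> and, multiplied by \<open>K + \<alpha>\<close>, at
      \<open>(N + 1, K - 1)\<close> are explicit multiples of \<open>W\<close>.\<close>
    define W where "W = moment N K / (T - 1 + a)"
    have W: "moment N K = (T - 1 + a) * W" using pos by (simp add: W_def)
    have X: "moment (N - 1) K = (T + a + \<gamma>) * W" if "N > 0"
    proof -
      have "moment N K * (T + a + \<gamma>) = (T - 1 + a) * moment (N - 1) K"
        using moment_Suc[of "N - 1" K] that by (simp add: T_def a_def of_nat_diff algebra_simps)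
      then have "(T - 1 + a) * moment (N - 1) K = (T - 1 + a) * ((T + a + \<gamma>) * W)"
        unfolding W by (simp only: mult_ac)
      then show ?thesis by (rule mult_left_cancel[THEN iffD1, rotated]) (use pos in simp)
    qed
    have Y: "(K + \<alpha>) * moment (N + 1) (K - 1) = 4 * (K + \<alpha> + \<kappa> + 1) * (T + a + \<gamma>) * W" if "K > 0"
    proof -
      have "moment N K * (4 * (K + \<alpha> + \<kappa> + 1)) = (K + \<alpha>) * moment (N + 2) (K - 1)"
        using moment_Suc_right[of N "K - 1"] that by (simp add: of_nat_diff algebra_simps)
      moreover have "moment (N + 2) (K - 1) * (T + a + \<gamma>) = (T - 1 + a) * moment (N + 1) (K - 1)"
        using moment_Suc[of "N + 1" "K - 1"] that by (simp add: T_def a_def of_nat_diff algebra_simps)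
      ultimately have "(T - 1 + a) * ((K + \<alpha>) * moment (N + 1) (K - 1))
          = (T - 1 + a) * (4 * (K + \<alpha> + \<kappa> + 1) * (T + a + \<gamma>) * W)"
        unfolding W by algebra
      then show ?thesis by (rule mult_left_cancel[THEN iffD1, rotated]) (use pos in simp)
    qed
    \<comment> \<open>The factor \<open>k * (k + \<alpha>)\<close> is split into
      \<open>k * (K + \<alpha>)\<close>, to which \<open>Y\<close> applies, and
      \<open>k * (k - K)\<close>, which equals \<open>- k * l\<close> and so is unchanged when the
      two monomials are exchanged.\<close>
    define E where "E n k = (n * (n - 1 + 4 * k + a)) * ((T + a + \<gamma>) * W)
      + k * (4 * (K + \<alpha> + \<kappa> + 1) * (T + a + \<gamma>) * W)
      + k * (k - K) * moment (N + 1) (K - 1)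
      - (n + 2 * k) * (n + 2 * k + a + \<gamma>) * ((T - 1 + a) * W)" for n k :: real
    have EE: "M (D1 \<alpha> \<gamma> \<kappa> (mon (i, j)) * mon (i', j')) = E i j"
      if "i + i' = N" "j + j' = K" for i j i' j'
    proof -
      have "M (D1 \<alpha> \<gamma> \<kappa> (mon (i, j)) * mon (i', j'))
        = (i * (real i - 1 + 4 * j + a)) * moment (i - 1 + i') K
          + j * (j + \<alpha>) * moment (N + 1) (j - 1 + j')
          - (i + 2 * j) * (i + 2 * j + a + \<gamma>) * moment N K"
        using that by (simp only: D1_mon distrib_right mult.assoc mon_mult M_add M_scale M_mon prod.sel)
          (simp add: a_def algebra_simps)
      also have "i * (real i - 1 + 4 * j + a) * moment (i - 1 + i') K
          = (i * (real i - 1 + 4 * j + a)) * ((T + a + \<gamma>) * W)"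
        using that X by (cases i) auto
      also have "j * (j + \<alpha>) * moment (N + 1) (j - 1 + j')
          = j * (4 * (K + \<alpha> + \<kappa> + 1) * (T + a + \<gamma>) * W) + j * (real j - K) * moment (N + 1) (K - 1)"
      proof (cases j)
        case (Suc j0)
        then have "K > 0" and "j - 1 + j' = K - 1" using that by auto
        then show ?thesis unfolding Y[OF \<open>K > 0\<close>, symmetric] by (simp add: algebra_simps)
      qed simp
      finally show ?thesis by (simp add: E_def W)
    qed
    have "M (D1 \<alpha> \<gamma> \<kappa> (mon z) * mon w) = E n k"
      unfolding z w by (rule EE) (simp_all add: N_def K_def)
    moreover have "M (mon z * D1 \<alpha> \<gamma> \<kappa> (mon w)) = E m l"
      unfolding z w mult.commute[of "mon _"] by (rule EE) (simp_all add: N_def K_def)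
    moreover have "E n k = E m l"
      by (simp add: E_def T_def N_def K_def a_def algebra_simps)
    ultimately show ?thesis by simp
  qed
qed

text \<open>As for the first operator, but only the moments at \<open>(N, K)\<close> and
  \<open>(N + 2, K - 1)\<close> occur, linked by a single recurrence.\<close>

lemma D2_symmetric_mon: "M (D2 \<alpha> \<kappa> (mon z) * mon w) = M (mon z * D2 \<alpha> \<kappa> (mon w))"
proof -
  obtain n k m l where z: "z = (n, k)" and w: "w = (m, l)" by fastforce
  define N K where "N = n + m" and "K = k + l"
  have Y: "(K + \<alpha>) * moment (N + 2) (K - 1) = moment N K * (4 * (K + \<alpha> + \<kappa> + 1))" if "K > 0"
    using moment_Suc_right[of N "K - 1"] that by (simp add: of_nat_diff algebra_simps)
  define E where "E k = k * (4 * k * moment N K) - k * (k - K) * moment (N + 2) (K - 1)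
      + k * (4 * (\<alpha> + \<kappa> + 1) * moment N K) - k * (moment N K * (4 * (K + \<alpha> + \<kappa> + 1)))" for k :: real
  have EE: "M (D2 \<alpha> \<kappa> (mon (i, j)) * mon (i', j')) = E j"
    if "i + i' = N" "j + j' = K" for i j i' j'
  proof -
    have "M (D2 \<alpha> \<kappa> (mon (i, j)) * mon (i', j'))
        = 4 * j * (j + \<alpha> + \<kappa> + 1) * moment N K - j * (j + \<alpha>) * moment (N + 2) (j - 1 + j')"
      using that by (simp only: D2_mon distrib_right mult.assoc mon_mult M_add M_scale M_mon prod.sel)
          (simp add: algebra_simps)
    also have "j * (j + \<alpha>) * moment (N + 2) (j - 1 + j')
          = j * (moment N K * (4 * (K + \<alpha> + \<kappa> + 1))) + j * (real j - K) * moment (N + 2) (K - 1)"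
    proof (cases j)
      case (Suc j0)
      then have "K > 0" and "j - 1 + j' = K - 1" using that by auto
      then show ?thesis unfolding Y[OF \<open>K > 0\<close>, symmetric] by (simp add: algebra_simps)
    qed simp
    finally show ?thesis by (simp add: E_def algebra_simps)
  qed
  have "M (D2 \<alpha> \<kappa> (mon z) * mon w) = E k"
    unfolding z w by (rule EE) (simp_all add: N_def K_def)
  moreover have "M (mon z * D2 \<alpha> \<kappa> (mon w)) = E l"
    unfolding z w mult.commute[of "mon _"] by (rule EE) (simp_all add: N_def K_def)
  moreover have "E k = E l"
    by (simp add: E_def K_def algebra_simps)
  ultimately show ?thesis by simp
qed

lemma symmetricI:
  assumes T: "bilin T" and mon: "\<And>z w. M (T (mon z) * mon w) = M (mon z * T (mon w))"
  shows "M (T f * g) = M (f * T g)"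
proof (induction f rule: bipoly_induct)
  case (add f1 f2)
  then show ?case by (simp add: bilin_add[OF T] distrib_right M_add)
next
  case (const_mon c z)
  have "M (T (mon z) * g) = M (mon z * T g)"
  proof (induction g rule: bipoly_induct)
    case (add g1 g2)
    then show ?case by (simp add: bilin_add[OF T] distrib_left M_add)
  next
    case (const_mon c w)
    then show ?case by (simp add: bilin_scale[OF T] mult.left_commute[of _ "biconst c"] M_scale mon)
  qed
  then show ?case by (simp add: bilin_scale[OF T] mult.assoc M_scale)
qed

text \<open>The integrand is nonnegative, hence zero almost everywhere, and the weight is positive
  on the open triangle \<open>I\<close>. So \<open>f(x + y, x y)\<close> vanishes on
  \<open>I\<close>, a nonempty open set being non-negligible, and the image of \<open>I\<close> in
  the (u, v) plane is large enough to force \<open>f = 0\<close>.\<close>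

lemma M_square_eq_0:
  assumes "M (f * f) = 0"
  shows "f = 0"
proof -
  define h where "h z = bieval f (fst z + snd z) (fst z * snd z)" for z
  define I where "I = {z :: real \<times> real. 0 < snd z} \<inter> {z. snd z < fst z} \<inter> {z. fst z + snd z < 1}"
  have "open I"
    unfolding I_def by (intro open_Int open_Collect_less continuous_intros)
  have sq: "integrand (f * f) z = indicator triangle z * ((h z)\<^sup>2 * weight \<alpha> \<gamma> \<kappa> (fst z) (snd z))" for z
    by (simp add: integrand_def h_def power2_eq_square)
  have "AE z in lborel. integrand (f * f) z = 0"
    using assms unfolding M_def
    by (subst (asm) integral_nonneg_eq_0_iff_AE[OF integrable_integrand]) (auto simp: sq weight_def)
  then have "AE z in lborel. z \<notin> I \<inter> {z. h z \<noteq> 0}"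
  proof eventually_elim
    case (elim z)
    then show ?case by (auto simp: sq I_def triangle_def weight_def indicator_def)
  qed
  moreover have "continuous_on UNIV h"
    unfolding h_def bieval_altdef by (intro continuous_intros)
  then have "open {z. h z \<noteq> 0}" by (intro open_Collect_neq) auto
  then have op: "open (I \<inter> {z. h z \<noteq> 0})" using \<open>open I\<close> by blast
  ultimately have "I \<inter> {z. h z \<noteq> 0} \<in> null_sets lborel"
    by (subst AE_iff_null_sets) auto
  then have "negligible (I \<inter> {z. h z \<noteq> 0})"
    by (simp add: negligible_iff_null_sets null_sets_completionI)
  then have zero: "h z = 0" if "z \<in> I" for z
    using open_not_negligible[OF op] that by blast
  show ?thesis
  proof (rule bipoly_eq_0I[of "{0<..<1/4}"])
    fix v :: real assume v: "v \<in> {0<..<1/4}"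
    have "sqrt v < 1 / 2"
      using v by (intro real_less_lsqrt) (auto simp: power2_eq_square)
    then have "infinite {2 * sqrt v<..<1}" by (simp add: infinite_Ioo)
    moreover have "bieval f u v = 0" if u: "u \<in> {2 * sqrt v<..<1}" for u
    proof -
      \<comment> \<open>The root of the discriminant of \<open>t\<^sup>2 - u t + v\<close>, whose
        zeros \<open>(u + s) / 2\<close> and \<open>(u - s) / 2\<close> are the wanted
        \<open>x\<close> and \<open>y\<close>.\<close>
      define s where "s = sqrt (u\<^sup>2 - 4 * v)"
      have "u > 0" using u v by (auto intro: le_less_trans[of 0 "2 * sqrt v"])
      have "(2 * sqrt v)\<^sup>2 < u\<^sup>2" using u v by (intro power_strict_mono) auto
      then have uv: "4 * v < u\<^sup>2" using v by (simp add: power_mult_distrib)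
      then have s: "s > 0" "s\<^sup>2 = u\<^sup>2 - 4 * v" by (simp_all add: s_def)
      have "s\<^sup>2 < u\<^sup>2" unfolding s(2) using v by simp
      then have "s < u" by (rule power2_less_imp_less) (use \<open>u > 0\<close> in simp)
      moreover have "u < 1" using u by simp
      ultimately have "((u + s) / 2, (u - s) / 2) \<in> I"
        using s(1) by (simp add: I_def flip: add_divide_distrib)
      moreover have "(u + s) / 2 + (u - s) / 2 = u" by (simp add: field_simps)
      moreover have "(u + s) / 2 * ((u - s) / 2) = v"
        using s(2) by (simp add: field_simps power2_eq_square)
      ultimately show ?thesis using zero[of "((u + s) / 2, (u - s) / 2)"] by (simp add: h_def)
    qed
    ultimately show "\<exists>U. infinite U \<and> (\<forall>u\<in>U. bieval f u v = 0)" by blast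
  qed (simp add: infinite_Ioo)
qed

section \<open>Monic orthogonal polynomials in u and v\<close>

definition monic_orth :: "nat \<times> nat \<Rightarrow> bipoly \<Rightarrow> bool" where
  "monic_orth z q \<longleftrightarrow> q - mon z \<in> low z \<and> (\<forall>w. prec w z \<longrightarrow> M (q * mon w) = 0)"

lemma orth_low:
  assumes "\<And>w. prec w z \<Longrightarrow> M (q * mon w) = 0" and "f \<in> low z"
  shows "M (q * f) = 0"
proof -
  obtain c where c: "f = (\<Sum>w | prec w z. biconst (c w) * mon w)"
    using assms(2) by (auto simp: low_def)
  show ?thesis
    unfolding c by (simp add: sum_distrib_left mult.left_commute[of q] M_sum M_scale assms(1))
qed

lemma monic_orth_low: "monic_orth z q \<Longrightarrow> f \<in> low z \<Longrightarrow> M (q * f) = 0"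
  unfolding monic_orth_def by (blast intro: orth_low)

text \<open>Gram-Schmidt, one monomial at a time: with \<open>g\<close> and \<open>e\<close> the
  residuals of \<open>f\<close> and \<open>mon a\<close> over \<open>S\<close>, the new residual is
  \<open>g\<close> minus its component along \<open>e\<close>. The induction hypothesis is needed
  for both, hence for arbitrary \<open>f\<close>.\<close>

lemma projection:
  assumes "finite S"
  shows "\<exists>c. \<forall>s\<in>S. M ((f - (\<Sum>t\<in>S. biconst (c t) * mon t)) * mon s) = 0"
  using assms
proof (induction S arbitrary: f)
  case (insert a S)
  obtain cf where cf: "\<And>s. s \<in> S \<Longrightarrow> M ((f - (\<Sum>t\<in>S. biconst (cf t) * mon t)) * mon s) = 0"
    using insert.IH[of f] by blast
  obtain ca where ca: "\<And>s. s \<in> S \<Longrightarrow> M ((mon a - (\<Sum>t\<in>S. biconst (ca t) * mon t)) * mon s) = 0"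
    using insert.IH[of "mon a"] by blast
  define g where "g = f - (\<Sum>t\<in>S. biconst (cf t) * mon t)"
  define h where "h = (\<Sum>t\<in>S. biconst (ca t) * mon t)"
  define e where "e = mon a - h"
  define r where "r = M (g * e) / M (e * e)"
  \<comment> \<open>If \<open>M (e * e) = 0\<close>, division by zero gives \<open>r = 0\<close>,
    and the equation still holds because \<open>e = 0\<close>.\<close>
  have r: "M (g * e) = r * M (e * e)"
    using M_square_eq_0[of e] by (cases "M (e * e) = 0") (auto simp: r_def M_0)
  define c where "c t = (if t = a then r else cf t - r * ca t)" for t
  have "(\<Sum>t\<in>insert a S. biconst (c t) * mon t)
      = biconst r * mon a + (\<Sum>t\<in>S. biconst (cf t - r * ca t) * mon t)"
    using insert.hyps by (auto simp: c_def intro!: sum.cong)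
  also have "\<dots> = biconst r * mon a + ((\<Sum>t\<in>S. biconst (cf t) * mon t) - biconst r * h)"
    by (simp add: h_def biconst_diff biconst_mult left_diff_distrib sum_subtractf sum_distrib_left mult.assoc)
  finally have eq: "f - (\<Sum>t\<in>insert a S. biconst (c t) * mon t) = g - biconst r * e"
    by (simp add: g_def e_def algebra_simps)
  have orth: "M ((g - biconst r * e) * mon s) = 0" if "s \<in> S" for s
    using cf[OF that] ca[OF that]
    by (simp add: left_diff_distrib[of g] mult.assoc M_diff M_scale flip: g_def h_def e_def)
  then have "M ((g - biconst r * e) * h) = 0"
    by (simp add: h_def sum_distrib_left mult.left_commute[of "g - biconst r * e"] M_sum M_scale)
  moreover have "M ((g - biconst r * e) * e) = 0"
    by (simp add: left_diff_distrib[of g] mult.assoc M_diff M_scale r)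
  ultimately have "M ((g - biconst r * e) * (e + h)) = 0"
    by (simp only: distrib_left M_add)
  then have "M ((g - biconst r * e) * mon a) = 0"
    by (simp add: e_def)
  then show ?case using orth eq by (intro exI[of _ c]) auto
qed simp

lemma monic_orth_exists: "\<exists>q. monic_orth z q"
proof -
  obtain c where c: "\<And>w. prec w z \<Longrightarrow> M ((mon z - (\<Sum>t | prec t z. biconst (c t) * mon t)) * mon w) = 0"
    using projection[OF finite_prec, of z "mon z"] by auto
  have "(0 :: bipoly) - (\<Sum>t | prec t z. biconst (c t) * mon t) \<in> low z"
    by (intro low_diff low_0 low_sumI)
  then have "monic_orth z (mon z - (\<Sum>t | prec t z. biconst (c t) * mon t))"
    by (simp add: monic_orth_def c)
  then show ?thesis ..
qed

text \<open>The leading terms cancel, so the difference lies in \<open>low z\<close>, to which it is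
  orthogonal; it is therefore orthogonal to itself.\<close>

lemma monic_orth_unique:
  assumes "monic_orth z p" "monic_orth z q"
  shows "p = q"
proof -
  have "(p - mon z) - (q - mon z) \<in> low z"
    using assms unfolding monic_orth_def by (blast intro: low_diff)
  then have "p - q \<in> low z" by simp
  moreover have "M ((p - q) * mon w) = 0" if "prec w z" for w
  proof -
    have "M (p * mon w) = 0" "M (q * mon w) = 0"
      using assms that unfolding monic_orth_def by blast+
    then show ?thesis by (simp add: left_diff_distrib M_diff)
  qed
  ultimately have "M ((p - q) * (p - q)) = 0" by (rule orth_low[rotated])
  then show ?thesis using M_square_eq_0 by fastforce
qed

text \<open>By triangularity the defect \<open>T q - e q\<close> lies in \<open>low z\<close>, which
  \<open>T\<close> preserves. Moving \<open>T\<close> to the other factor shows that the defect is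
  orthogonal to \<open>low z\<close>, hence to itself.\<close>

lemma monic_orth_eigen:
  assumes T: "bilin T" and sym: "\<And>f g. M (T f * g) = M (f * T g)"
    and tri: "\<And>z. T (mon z) - biconst (e z) * mon z \<in> low z" and q: "monic_orth z q"
  shows "T q = biconst (e z) * q"
proof -
  have orth: "M (q * f) = 0" if "f \<in> low z" for f
    using q that by (rule monic_orth_low)
  have Tlow: "T f \<in> low z" if "f \<in> low z" for f
  proof (rule low_map[OF T _ that])
    fix w assume w: "prec w z"
    have "(T (mon w) - biconst (e w) * mon w) + biconst (e w) * mon w \<in> low z"
      by (intro low_add low_mono[OF w] tri low_scale low_mon w)
    then show "T (mon w) \<in> low z" by simp
  qed
  let ?d = "T q - biconst (e z) * q"
  have l: "q - mon z \<in> low z" using q by (simp add: monic_orth_def)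
  have "?d = (T (mon z) - biconst (e z) * mon z) + (T (q - mon z) - biconst (e z) * (q - mon z))"
    by (simp add: bilin_diff[OF T] algebra_simps)
  also have "\<dots> \<in> low z"
    by (intro low_add tri low_diff[OF Tlow[OF l] low_scale[OF l]])
  finally have d: "?d \<in> low z" .
  have "M (?d * ?d) = M (T q * ?d) - e z * M (q * ?d)"
    by (simp add: left_diff_distrib[of "T q"] mult.assoc M_diff M_scale)
  also have "\<dots> = 0"
    using orth[OF d] orth[OF Tlow[OF d]] by (simp add: sym)
  finally show ?thesis using M_square_eq_0 by fastforce
qed

section \<open>Joint eigenvalues\<close>

definition ev1 :: "nat \<times> nat \<Rightarrow> real" where
  "ev1 z = - (real (fst z) + 2 * real (snd z))
    * (real (fst z) + 2 * real (snd z) + (2 * \<alpha> + 2 * \<kappa> + 3) + \<gamma>)"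

definition ev2 :: "nat \<times> nat \<Rightarrow> real" where
  "ev2 z = 4 * real (snd z) * (real (snd z) + \<alpha> + \<kappa> + 1)"

lemma D1_eigen:
  assumes "monic_orth z q"
  shows "D1 \<alpha> \<gamma> \<kappa> q = biconst (ev1 z) * q"
proof (rule monic_orth_eigen[OF bilin_D1 symmetricI[OF bilin_D1 D1_symmetric_mon] _ assms])
  fix z :: "nat \<times> nat"
  obtain n k where z: "z = (n, k)" by fastforce
  have "biconst (real n * c) * mon (n - 1, k) \<in> low (n, k)" for c
    by (cases n) (auto intro!: low_0 low_scale low_mon simp: prec_iff)
  moreover have "biconst (real k * c) * mon (n + 1, k - 1) \<in> low (n, k)" for c
    by (cases k) (auto intro!: low_0 low_scale low_mon simp: prec_iff)
  ultimately show "D1 \<alpha> \<gamma> \<kappa> (mon z) - biconst (ev1 z) * mon z \<in> low z"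
    by (simp only: z D1_mon ev1_def prod.sel add_diff_cancel_right' low_add)
qed

lemma D2_eigen:
  assumes "monic_orth z q"
  shows "D2 \<alpha> \<kappa> q = biconst (ev2 z) * q"
proof (rule monic_orth_eigen[OF bilin_D2 symmetricI[OF bilin_D2 D2_symmetric_mon] _ assms])
  fix z :: "nat \<times> nat"
  obtain n k where z: "z = (n, k)" by fastforce
  have "biconst (- (real k * c)) * mon (n + 2, k - 1) \<in> low (n, k)" for c
    by (cases k) (auto intro!: low_0 low_scale low_mon simp: prec_iff)
  then show "D2 \<alpha> \<kappa> (mon z) - biconst (ev2 z) * mon z \<in> low z"
    by (simp only: z D2_mon ev2_def prod.sel add_diff_cancel_right')
qed

text \<open>If the substituted polynomials agree, the square of the difference has zero integral and
  positivity applies. This makes the description defining \<open>q_poly\<close> unique.\<close>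

lemma bieval_sum_prod_eq_iff:
  "(\<forall>x y. bieval f (x + y) (x * y) = bieval g (x + y) (x * y)) \<longleftrightarrow> f = g"
proof
  assume "\<forall>x y. bieval f (x + y) (x * y) = bieval g (x + y) (x * y)"
  then have "integrand ((f - g) * (f - g)) = (\<lambda>_. 0)"
    by (simp add: integrand_def fun_eq_iff)
  then have "M ((f - g) * (f - g)) = 0" by (simp add: M_def)
  then show "f = g" using M_square_eq_0 by fastforce
qed simp

lemma set_integral_triangle:
  assumes "\<And>x y. bieval p x y = bieval f (x + y) (x * y)" "\<And>x y. bieval q x y = bieval g (x + y) (x * y)"
  shows "(LINT (x, y) : triangle | lborel. bieval p x y * bieval q x y * weight \<alpha> \<gamma> \<kappa> x y) = M (f * g)"
  unfolding set_lebesgue_integral_def M_def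
  by (intro Bochner_Integration.integral_cong refl)
    (simp add: integrand_def assms split_beta mult.assoc)

text \<open>The substitution sends \<open>mon w\<close> to \<open>sym_monom w\<close>, so
  \<open>p\<close> and \<open>q\<close> share their coefficients, and test polynomials of smaller
  symmetric degree correspond to elements of \<open>low (n, k)\<close>.\<close>

lemma is_monic_orthogonal_iff:
  "is_monic_orthogonal \<alpha> \<gamma> \<kappa> n k p \<longleftrightarrow>
    (\<exists>q. monic_orth (n, k) q \<and> (\<forall>x y. bieval p x y = bieval q (x + y) (x * y)))"
proof
  assume p: "is_monic_orthogonal \<alpha> \<gamma> \<kappa> n k p"
  then obtain c where c: "p = sym_monom (n, k) + (\<Sum>w | prec w (n, k). biconst (c w) * sym_monom w)"
    unfolding is_monic_orthogonal_def by blast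
  define q where "q = mon (n, k) + (\<Sum>w | prec w (n, k). biconst (c w) * mon w)"
  have pq: "bieval p x y = bieval q (x + y) (x * y)" for x y
    by (simp add: c q_def)
  have "M (q * mon w) = 0" if w: "prec w (n, k)" for w
  proof -
    \<comment> \<open>A single \<open>sym_monom w\<close> is an admissible test polynomial, which
      gives orthogonality to \<open>mon w\<close>.\<close>
    have "symmetric (sym_monom w)" by (simp add: symmetric_def add.commute mult.commute)
    moreover have "has_sym_degree (sym_monom w) w"
    proof -
      have "{z. (if z = w then 1 else 0 :: real) \<noteq> 0} = {w}" by auto
      then show ?thesis unfolding has_sym_degree_def
        by (intro exI[of _ "\<lambda>z. if z = w then 1 else 0"]) simp
    qed
    ultimately have "(LINT (x, y) : triangle | lborel.
        bieval p x y * bieval (sym_monom w) x y * weight \<alpha> \<gamma> \<kappa> x y) = 0"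
      using p w unfolding is_monic_orthogonal_def by blast
    then show ?thesis using set_integral_triangle[OF pq, of "sym_monom w" "mon w"] by simp
  qed
  then have "monic_orth (n, k) q" by (simp add: monic_orth_def q_def low_sumI)
  then show "\<exists>q. monic_orth (n, k) q \<and> (\<forall>x y. bieval p x y = bieval q (x + y) (x * y))"
    using pq by blast
next
  assume "\<exists>q. monic_orth (n, k) q \<and> (\<forall>x y. bieval p x y = bieval q (x + y) (x * y))"
  then obtain q where q: "monic_orth (n, k) q" and pq: "\<And>x y. bieval p x y = bieval q (x + y) (x * y)"
    by blast
  obtain c where "q - mon (n, k) = (\<Sum>w | prec w (n, k). biconst (c w) * mon w)"
    using q by (auto simp: monic_orth_def low_def)
  then have c: "q = mon (n, k) + (\<Sum>w | prec w (n, k). biconst (c w) * mon w)"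
    by (simp add: algebra_simps)
  show "is_monic_orthogonal \<alpha> \<gamma> \<kappa> n k p"
    unfolding is_monic_orthogonal_def
  proof (intro conjI allI impI exI)
    show "symmetric p" by (simp add: symmetric_def pq add.commute mult.commute)
    show "p = sym_monom (n, k) + (\<Sum>w | prec w (n, k). biconst (c w) * sym_monom w)"
      by (rule bipoly_eqI) (simp add: pq c)
    fix s d assume "has_sym_degree s d" and d: "prec d (n, k)"
    then obtain b where b: "finite {z. b z \<noteq> 0}" "s = (\<Sum>z | b z \<noteq> 0. biconst (b z) * sym_monom z)"
      "\<And>z. b z \<noteq> 0 \<Longrightarrow> z = d \<or> prec z d"
      unfolding has_sym_degree_def by blast
    define g where "g = (\<Sum>z | b z \<noteq> 0. biconst (b z) * mon z)"
    have "g \<in> low (n, k)"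
      unfolding g_def using b(3) d by (intro low_sum low_scale low_mon) (auto intro: prec_trans)
    with q have "M (q * g) = 0" by (rule monic_orth_low)
    then show "(LINT (x, y) : triangle | lborel. bieval p x y * bieval s x y * weight \<alpha> \<gamma> \<kappa> x y) = 0"
      using set_integral_triangle[OF pq, of s g] by (simp add: b(2) g_def)
  qed
qed

text \<open>Resolves both definite descriptions: \<open>p\<close> is built from the Gram-Schmidt
  \<open>q\<close> and is unique because \<open>q\<close> is, and then \<open>q\<close> is recovered
  from \<open>p\<close>.\<close>

lemma monic_orth_q_poly: "monic_orth (n, k) (q_poly \<alpha> \<gamma> \<kappa> n k)"
proof -
  obtain q where q: "monic_orth (n, k) q" using monic_orth_exists by blast
  obtain c where "q - mon (n, k) = (\<Sum>w | prec w (n, k). biconst (c w) * mon w)"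
    using q by (auto simp: monic_orth_def low_def)
  then have c: "q = mon (n, k) + (\<Sum>w | prec w (n, k). biconst (c w) * mon w)"
    by (simp add: algebra_simps)
  define p where "p = sym_monom (n, k) + (\<Sum>w | prec w (n, k). biconst (c w) * sym_monom w)"
  have pq: "bieval p x y = bieval q (x + y) (x * y)" for x y
    by (simp add: c p_def)
  have "p_poly \<alpha> \<gamma> \<kappa> n k = p"
    unfolding p_poly_def
  proof (rule the_equality)
    show "is_monic_orthogonal \<alpha> \<gamma> \<kappa> n k p"
      using q pq by (auto simp: is_monic_orthogonal_iff)
    fix p' assume "is_monic_orthogonal \<alpha> \<gamma> \<kappa> n k p'"
    then obtain q' where "monic_orth (n, k) q'" "\<And>x y. bieval p' x y = bieval q' (x + y) (x * y)"
      by (auto simp: is_monic_orthogonal_iff)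
    then show "p' = p"
      using monic_orth_unique[OF q] pq by (intro bipoly_eqI) simp
  qed
  then have "q_poly \<alpha> \<gamma> \<kappa> n k = q"
    unfolding q_poly_def by (simp add: pq bieval_sum_prod_eq_iff)
  then show ?thesis using q by simp
qed

lemma monic_orth_nonzero:
  assumes "monic_orth z q"
  shows "q \<noteq> 0"
proof
  assume "q = 0"
  then obtain c where "- mon z = (\<Sum>w | prec w z. biconst (c w) * mon w)"
    using assms by (auto simp: monic_orth_def low_def)
  then have "coeff (coeff (- mon z) (snd z)) (fst z)
      = coeff (coeff (\<Sum>w | prec w z. biconst (c w) * mon w) (snd z)) (fst z)"
    by simp
  also have "\<dots> = (\<Sum>w | prec w z. 0)"
    unfolding coeff_sum
    by (intro sum.cong refl) (auto simp: biconst_def coeff_mon prec_iff)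
  finally show False by (simp add: coeff_mon)
qed

text \<open>The second eigenvalue depends only on \<open>k\<close> and takes infinitely many values;
  for each fixed \<open>k\<close> the first takes infinitely many as \<open>n\<close>
  varies.\<close>

lemma bieval_ev_eq_0:
  assumes "\<And>z. bieval P (ev1 z) (ev2 z) = 0"
  shows "P = 0"
proof (rule bipoly_eq_0I[of "range (\<lambda>k. ev2 (0, k))"])
  have inj: "inj (\<lambda>m :: nat. a * (real m * (real m + b)))" if "b > -1" "a \<noteq> 0" for a b :: real
  proof (rule injI)
    fix x y :: nat
    assume "a * (real x * (real x + b)) = a * (real y * (real y + b))"
    then have "real x * (real x + b) = real y * (real y + b)" using that by simp
    then have "(real x - real y) * (real x + real y + b) = 0" by (simp add: algebra_simps)
    then consider "x = y" | "real x + real y + b = 0" by auto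
    then show "x = y"
    proof cases
      \<comment> \<open>Here \<open>x + y = - b < 1\<close>, so both naturals are 0.\<close>
      case 2
      then have "real (x + y) < 1" using that by simp
      then show ?thesis by simp
    qed
  qed
  have "inj (\<lambda>k. ev2 (0, k))"
    using inj[of "\<alpha> + \<kappa> + 1" 4] \<alpha>\<kappa> by (simp add: ev2_def mult.assoc add.assoc)
  then show "infinite (range (\<lambda>k. ev2 (0, k)))" by (simp add: finite_image_iff)
  fix v assume "v \<in> range (\<lambda>k. ev2 (0, k))"
  then obtain k where k: "v = ev2 (0, k)" by blast
  define F where "F m = (-1) * (real m * (real m + (2 * \<alpha> + 2 * \<kappa> + 3 + \<gamma>)))" for m
  have "inj F"
    unfolding F_def using \<alpha>\<kappa> \<gamma> by (intro inj) auto
  moreover have "ev1 (n, k) = F (n + 2 * k)" for n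
    by (simp add: ev1_def F_def algebra_simps)
  ultimately have "inj (\<lambda>n. ev1 (n, k))"
    by (simp add: inj_eq inj_on_def[of "\<lambda>n. F (n + 2 * k)"])
  then have "infinite (range (\<lambda>n. ev1 (n, k)))" by (simp add: finite_image_iff)
  moreover have "bieval P u v = 0" if "u \<in> range (\<lambda>n. ev1 (n, k))" for u
    using that assms[of "(_, k)"] by (auto simp: k ev2_def)
  ultimately show "\<exists>U. infinite U \<and> (\<forall>u\<in>U. bieval P u v = 0)" by blast
qed

end

theorem theorem8p2:
  fixes \<alpha> \<gamma> \<kappa> :: real and D :: "bipoly \<Rightarrow> bipoly"
  assumes "\<alpha> > -1" and "\<gamma> > -1" and "\<kappa> > -1" and "\<alpha> + \<kappa> > -3/2"
    and "linear_pdo D"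
    and "admits_eigenfunctions D (q_poly \<alpha> \<gamma> \<kappa>)"
  shows "\<exists>!P :: bipoly. D = poly_op P (D1 \<alpha> \<gamma> \<kappa>) (D2 \<alpha> \<kappa>)"
proof -
  interpret jacobi_triangle \<alpha> \<gamma> \<kappa> using assms(1-4) by unfold_locales
  define q where "q z = q_poly \<alpha> \<gamma> \<kappa> (fst z) (snd z)" for z
  have q: "monic_orth z (q z)" for z
    using monic_orth_q_poly[of "fst z" "snd z"] by (simp add: q_def)
  then have span: "q z - mon z \<in> low z" for z by (simp add: monic_orth_def)
  have nz: "q z \<noteq> 0" for z using q monic_orth_nonzero by blast
  note ev = D1_eigen[OF q] D2_eigen[OF q]
  have op: "poly_op P (D1 \<alpha> \<gamma> \<kappa>) (D2 \<alpha> \<kappa>) (q z) = biconst (bieval P (ev1 z) (ev2 z)) * q z" for P z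
    by (rule poly_op_eigen[OF bilin_D1 bilin_D2 ev])
  show ?thesis
  proof (rule ex_ex1I)
    obtain P where P: "\<And>f l1 l2 l. D1 \<alpha> \<gamma> \<kappa> f = biconst l1 * f \<Longrightarrow> D2 \<alpha> \<kappa> f = biconst l2 * f \<Longrightarrow>
        D f = biconst l * f \<Longrightarrow> f \<noteq> 0 \<Longrightarrow> l = bieval P l1 l2"
      using eigenvalue_polynomial[OF assms(1,2,5), of \<kappa>] by blast
    have "D = poly_op P (D1 \<alpha> \<gamma> \<kappa>) (D2 \<alpha> \<kappa>)"
    \<comment> \<open>Two linear maps are compared on the \<open>q z\<close>, where each acts by a
      scalar, and \<open>P\<close> was chosen to make these scalars equal.\<close>
    proof (rule bilin_eqI[OF bilin_linear_pdo[OF assms(5)] bilin_poly_op[OF bilin_D1 bilin_D2] span])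
      fix z
      obtain l where l: "D (q z) = biconst l * q z"
        using assms(6) unfolding admits_eigenfunctions_def q_def by blast
      then show "D (q z) = poly_op P (D1 \<alpha> \<gamma> \<kappa>) (D2 \<alpha> \<kappa>) (q z)"
        using P[OF ev l nz] by (simp add: op)
    qed
    then show "\<exists>P. D = poly_op P (D1 \<alpha> \<gamma> \<kappa>) (D2 \<alpha> \<kappa>)" ..
  next
    fix P P'
    assume P: "D = poly_op P (D1 \<alpha> \<gamma> \<kappa>) (D2 \<alpha> \<kappa>)" "D = poly_op P' (D1 \<alpha> \<gamma> \<kappa>) (D2 \<alpha> \<kappa>)"
    have "bieval (P - P') (ev1 z) (ev2 z) = 0" for z
    proof -
      \<comment> \<open>Both polynomials give the eigenvalue of \<open>D\<close> on
        \<open>q z\<close>, which may be cancelled because it is nonzero.\<close>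
      have "biconst (bieval P (ev1 z) (ev2 z)) = biconst (bieval P' (ev1 z) (ev2 z))"
        using op[of P z] op[of P' z] nz[of z] P by simp
      then show ?thesis by (simp add: biconst_def)
    qed
    then have "P - P' = 0" by (rule bieval_ev_eq_0)
    then show "P = P'" by simp
  qed
qed

end
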